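(* For every integer $n\geq 19$ there exists a connected matroid $\mathsf{M}$ on $n$ elements such that its base polytope $\mathscr{P}(\mathsf{M})$ is not Ehrhart positive.
   Context: For a matroid $\mathsf{M}$ on $E=\{1,\ldots,n\}$ with set of bases $\mathscr{B}$, the base polytope is $\mathscr{P}(\mathsf{M})=\operatorname{conv}\{e_B : B\in\mathscr{B}\}\subseteq\mathbb{R}^n$, where $e_B=\sum_{i\in B}e_i$ and $e_i$ is the $i$-th canonical basis vector. The Ehrhart polynomial of a lattice polytope $\mathscr{P}\subseteq\mathbb{R}^n$ is the polynomial $\operatorname{ehr}(\mathscr{P},t)$ of degree $\dim\mathscr{P}$ with $\operatorname{ehr}(\mathscr{P},t)=\#(t\mathscr{P}\cap\mathbb{Z}^n)$ for all nonnegative integers $t$. The polytope $\mathscr{P}$ is Ehrhart positive if all coefficients of $\operatorname{ehr}(\mathscr{P},t)$ (in degrees $0,\ldots,\dim\mathscr{P}$) are positive. A matroid is connected if for every pair of distinct elements of the ground set there is a circuit containing both. *)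

theory Defs
  imports "HOL-Analysis.Analysis" "HOL-Computational_Algebra.Polynomial"
begin

definition matroid :: "'a set \<Rightarrow> 'a set set \<Rightarrow> bool" where
  "matroid E \<B> \<longleftrightarrow> finite E \<and> \<B> \<noteq> {} \<and> \<B> \<subseteq> Pow E \<and>
     (\<forall>A\<in>\<B>. \<forall>B\<in>\<B>. \<forall>x\<in>A - B. \<exists>y\<in>B - A. insert y (A - {x}) \<in> \<B>)"

definition matroid_indep :: "'a set set \<Rightarrow> 'a set \<Rightarrow> bool" where
  "matroid_indep \<B> I \<longleftrightarrow> (\<exists>B\<in>\<B>. I \<subseteq> B)"

definition matroid_circuit :: "'a set \<Rightarrow> 'a set set \<Rightarrow> 'a set \<Rightarrow> bool" where
  "matroid_circuit E \<B> C \<longleftrightarrow>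
     C \<subseteq> E \<and> \<not> matroid_indep \<B> C \<and> (\<forall>D. D \<subset> C \<longrightarrow> matroid_indep \<B> D)"

definition matroid_connected :: "'a set \<Rightarrow> 'a set set \<Rightarrow> bool" where
  "matroid_connected E \<B> \<longleftrightarrow>
     (\<forall>x\<in>E. \<forall>y\<in>E. x \<noteq> y \<longrightarrow> (\<exists>C. matroid_circuit E \<B> C \<and> x \<in> C \<and> y \<in> C))"

text \<open>The ground set of the matroid is all of the finite index type \<open>'n\<close>, so that the
  polytope lives in \<open>real ^ 'n\<close>.\<close>

definition base_polytope :: "'n::finite set set \<Rightarrow> (real ^ 'n) set" where
  "base_polytope \<B> = convex hull ((\<lambda>B. \<Sum>i\<in>B. axis i 1) ` \<B>)"

definition integer_points :: "(real ^ 'n::finite) set" where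
  "integer_points = {x. \<forall>i. x $ i \<in> \<int>}"

definition is_ehrhart_poly :: "(real ^ 'n::finite) set \<Rightarrow> real poly \<Rightarrow> bool" where
  "is_ehrhart_poly P p \<longleftrightarrow> int (degree p) = aff_dim P \<and>
     (\<forall>t::nat. poly p (of_nat t) = real (card ((\<lambda>x. real t *\<^sub>R x) ` P \<inter> integer_points)))"

lemma is_ehrhart_poly_unique:
  assumes "is_ehrhart_poly P p" "is_ehrhart_poly P q"
  shows "p = q"
proof (rule ccontr)
  assume "p \<noteq> q"
  then have "finite {x. poly (p - q) x = 0}"
    by (intro poly_roots_finite) simp
  moreover have "range (of_nat :: nat \<Rightarrow> real) \<subseteq> {x. poly (p - q) x = 0}"
    using assms by (auto simp: is_ehrhart_poly_def)
  ultimately have "finite (range (of_nat :: nat \<Rightarrow> real))"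
    by (rule rev_finite_subset)
  then show False
    using finite_imageD[of "of_nat :: nat \<Rightarrow> real" UNIV] inj_of_nat infinite_UNIV_nat by blast
qed

text \<open>For a lattice polytope existence is Ehrhart's theorem; nothing is known about this value for a
  set \<open>P\<close> that has no Ehrhart polynomial.\<close>

definition ehrhart_poly :: "(real ^ 'n::finite) set \<Rightarrow> real poly" where
  "ehrhart_poly P = (THE p. is_ehrhart_poly P p)"

definition ehrhart_positive :: "(real ^ 'n::finite) set \<Rightarrow> bool" where
  "ehrhart_positive P \<longleftrightarrow> (\<forall>k. int k \<le> aff_dim P \<longrightarrow> coeff (ehrhart_poly P) k > 0)"

end

theory Submission imports Defs begin

text \<open>
  Let \<open>\<H>\<close> be a family of \<open>k\<close>-sets that pairwise share at most \<open>k - 2\<close> points. The remaining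
  \<open>k\<close>-sets are the bases of a sparse paving matroid. Its base polytope is the hypersimplex with the
  corners \<open>x(H) > k - 1\<close>, \<open>H \<in> \<H>\<close>, cut off. These corners are disjoint and congruent, so the
  Ehrhart polynomial is that of the hypersimplex minus \<open>|\<H>|\<close> times a fixed polynomial. For \<open>k\<close> near
  \<open>n / 2\<close> the quadratic coefficient of the hypersimplex grows only polynomially in \<open>n\<close>, while
  \<open>|\<H>|\<close> can be taken so large (Graham and Sloane: at least \<open>(n choose k) / n\<close>) that \<open>|\<H>|\<close> times
  the quadratic coefficient of a corner grows exponentially. The latter dominates from \<open>n = 20\<close> on. For
  \<open>n = 19\<close> it dominates for a denser code with 6327 words.
\<close>

section \<open>Constant weight codes\<close>

text \<open>Why degree two: the linear coefficient of a corner is 1 / ((n-1) * (n-2 choose k-1)), so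
  even (n choose k) corners would lower the linear coefficient by no more than n / (k (n-k)). In
  degree two the recursion for the corner polynomial contributes an extra term 1 / ((k-1)(n-1)). It
  is only polynomially small, and the exponentially many corners multiply it. Since
  \<open>ehrhart_poly\<close> is a definite description, a polynomial has to be exhibited that has
  the right value at every t and whose degree is exactly the dimension. This calls for an inequality
  description of the polytope, for exact lattice point counts valid from t = 0 on, and for a
  separate growth argument for the degree, because the leading terms of the hypersimplex and of the
  corners could a priori cancel.\<close>

definition distance_four :: "nat \<Rightarrow> 'a set set \<Rightarrow> bool" where
  "distance_four k \<H> \<longleftrightarrow> (\<forall>H\<in>\<H>. card H = k) \<and>
     (\<forall>H\<in>\<H>. \<forall>K\<in>\<H>. H \<noteq> K \<longrightarrow> card (H \<inter> K) + 2 \<le> k)"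

lemma adjacent_subsets:
  assumes "finite H" "finite K" "card H = k" "card K = k" "H \<noteq> K" "\<not> card (H \<inter> K) + 2 \<le> k"
  obtains x y where "x \<in> H" "y \<in> K" "x \<notin> K" "y \<notin> H" "H - {x} = K - {y}"
proof -
  have "\<not> H \<subseteq> K" using assms by (metis card_subset_eq)
  then have "card (H \<inter> K) < card H"
    using assms(1) by (metis Int_lower1 inf.absorb_iff1 psubset_card_mono psubsetI)
  then have c: "card (H \<inter> K) + 1 = k" using assms by linarith
  have "card (H - K) = 1" "card (K - H) = 1"
    using c assms(1-4) by (simp_all add: card_Diff_subset_Int Int_commute)
  then obtain x y where "H - K = {x}" "K - H = {y}" by (metis card_1_singletonE)
  then show ?thesis by (intro that[of x y]) blast+
qed

text \<open>Label the ground set by the residues modulo n and sort the k-sets by their label sum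
  modulo n. Two sets that are too close differ by swapping one element for another, which changes
  the sum, so each class is a code. Some class is at least as large as the average.\<close>

lemma graham_sloane:
  fixes k :: nat
  defines "n \<equiv> CARD('n::finite)"
  shows "\<exists>\<H> :: 'n set set. distance_four k \<H> \<and> n choose k \<le> n * card \<H>"
proof -
  obtain f :: "'n \<Rightarrow> nat" where f: "bij_betw f UNIV {..<n}"
    using ex_bij_betw_finite_nat[of "UNIV :: 'n set"] by (auto simp: n_def lessThan_atLeast0)
  have n0: "n > 0" by (simp add: n_def)
  define F where "F r = {H :: 'n set. card H = k \<and> sum f H mod n = r}" for r
  have "n choose k = card {H :: 'n set. card H = k}"
    using n_subsets[of "UNIV :: 'n set" k] by (simp add: n_def)
  also have "{H :: 'n set. card H = k} = (\<Union>r<n. F r)"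
    using n0 by (auto simp: F_def)
  also have "card \<dots> \<le> (\<Sum>r<n. card (F r))" by (rule card_UN_le) simp
  finally have le: "n choose k \<le> (\<Sum>r<n. card (F r))" .
  have "\<exists>r. n choose k \<le> n * card (F r)"
  proof (rule ccontr)
    assume "\<not> ?thesis"
    then have *: "n * card (F r) < n choose k" for r by (simp add: not_le)
    have "n * (\<Sum>r<n. card (F r)) = (\<Sum>r<n. n * card (F r))" by (simp add: sum_distrib_left)
    also have "\<dots> < (\<Sum>r<n. n choose k)" using n0 * by (intro sum_strict_mono) auto
    also have "\<dots> = n * (n choose k)" by simp
    finally show False using le n0 by simp
  qed
  then obtain r where r: "n choose k \<le> n * card (F r)" ..
  have "distance_four k (F r)" unfolding distance_four_def
  proof (intro conjI ballI impI)
    fix H K assume HK: "H \<in> F r" "K \<in> F r" "H \<noteq> K"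
    show "card (H \<inter> K) + 2 \<le> k"
    proof (rule ccontr)
      assume "\<not> ?thesis"
      then obtain x y where xy: "x \<in> H" "y \<in> K" "x \<notin> K" "y \<notin> H" "H - {x} = K - {y}"
        using HK adjacent_subsets[of H K k] by (auto simp: F_def)
      have "sum f H = sum f (H - {x}) + f x" "sum f K = sum f (H - {x}) + f y"
        using xy by (simp_all add: sum.remove add.commute)
      then have "(sum f (H - {x}) + f x) mod n = (sum f (H - {x}) + f y) mod n"
        using HK by (simp add: F_def)
      then have "f x mod n = f y mod n"
        by (simp add: nat_mod_eq_iff)
      moreover have "f x < n" "f y < n" using f by (auto simp: bij_betw_def)
      ultimately have "x = y" using f by (auto simp: bij_betw_def inj_on_def)
      then show False using xy by simp
    qed
  qed (auto simp: F_def)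
  with r show ?thesis by blast
qed

section \<open>Sparse paving matroids\<close>

lemma card_Compl: "card (- A) = CARD('a::finite) - card (A :: 'a set)"
  by (simp add: Compl_eq_Diff_UNIV card_Diff_subset)

text \<open>The members of \<H> become the circuit-hyperplanes of the matroid, whence the names of
  the facts below. The rank bounds leave at least three elements outside every k-set and keep the
  barycentre of the hypersimplex out of every corner (\<open>rank_sq_less\<close>).\<close>

locale sparse_paving =
  fixes \<H> :: "'n::finite set set" and k :: nat
  assumes distance_four: "distance_four k \<H>"
    and rank_ge_3: "3 \<le> k" and rank_le_half: "2 * k \<le> CARD('n)"
begin

definition "bases = {B. card B = k} - \<H>"

lemma card_hyperplane: "H \<in> \<H> \<Longrightarrow> card H = k"
  using distance_four by (simp add: distance_four_def)

lemma card_Int_hyperplanes: "H \<in> \<H> \<Longrightarrow> K \<in> \<H> \<Longrightarrow> H \<noteq> K \<Longrightarrow> card (H \<inter> K) + 2 \<le> k"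
  using distance_four by (simp add: distance_four_def)

lemma hyperplane_unique:
  assumes "H \<in> \<H>" "K \<in> \<H>" "Z \<subseteq> H" "Z \<subseteq> K" "k \<le> card Z + 1"
  shows "H = K"
proof (rule ccontr)
  assume "H \<noteq> K"
  moreover have "card Z \<le> card (H \<inter> K)" using assms by (intro card_mono) auto
  ultimately show False using card_Int_hyperplanes[of H K] assms by linarith
qed

text \<open>The new set shares k - 1 points with \<open>H\<close>, which is too close for another
  member of \<H>.\<close>

lemma insert_in_bases:
  assumes "card Z + 1 = k" "Z \<subseteq> H" "H \<in> \<H>" "w \<notin> H"
  shows "insert w Z \<in> bases"
  using assms hyperplane_unique[of "insert w Z" H Z] by (auto simp: bases_def card_insert_if)

text \<open>Two completions would share the k - 1 points of \<open>Z\<close>. Hence, of any two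
  candidates for completing \<open>Z\<close>, at least one yields a basis.\<close>

lemma card_hyperplane_extensions:
  assumes "card Z + 1 = k"
  shows "card {u. u \<notin> Z \<and> insert u Z \<in> \<H>} \<le> 1"
proof -
  have "u = v" if "u \<notin> Z" "insert u Z \<in> \<H>" "v \<notin> Z" "insert v Z \<in> \<H>" for u v
    using hyperplane_unique[of "insert u Z" "insert v Z" Z] that assms by auto
  then show ?thesis by (auto simp: card_le_Suc0_iff_eq)
qed

lemma bases_nonempty: "bases \<noteq> {}"
proof -
  have "k - 1 \<le> CARD('n)" using rank_le_half by simp
  then obtain Z :: "'n set" where Z: "card Z = k - 1"
    by (metis obtain_subset_with_card_n)
  then have Z1: "card Z + 1 = k" using rank_ge_3 by simp
  have "\<not> - Z \<subseteq> {u. u \<notin> Z \<and> insert u Z \<in> \<H>}"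
  proof
    assume "- Z \<subseteq> {u. u \<notin> Z \<and> insert u Z \<in> \<H>}"
    then have "card (- Z) \<le> 1"
      by (rule order_trans[OF card_mono[OF finite] card_hyperplane_extensions[OF Z1]])
    then show False using Z1 rank_ge_3 rank_le_half by (simp add: card_Compl)
  qed
  then show ?thesis using Z1 by (auto simp: bases_def card_insert_if)
qed

text \<open>If \<open>B - A\<close> is a single point, the exchange produces \<open>B\<close>
  itself. Otherwise there are at least two candidates and at most one of them is blocked.\<close>

lemma matroid_bases: "matroid UNIV bases"
  unfolding matroid_def
proof (intro conjI ballI)
  fix A B x assume A: "A \<in> bases" and B: "B \<in> bases" and x: "x \<in> A - B"
  let ?Z = "A - {x}"
  have Z: "card ?Z + 1 = k" using A x rank_ge_3 by (simp add: bases_def)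
  show "\<exists>y\<in>B - A. insert y ?Z \<in> bases"
  proof (cases "card (B - A) = 1")
    case True
    then obtain y where y: "B - A = {y}" by (rule card_1_singletonE)
    have "card (A - B) = card (B - A)"
      using A B by (simp add: bases_def card_Diff_subset_Int Int_commute)
    then have "card (A - B) = 1" using True by simp
    then obtain x' where "A - B = {x'}" by (rule card_1_singletonE)
    then have "A - B = {x}" using x by simp
    then have "insert y ?Z = B" using y by auto
    then show ?thesis using y B by auto
  next
    case False
    have "card (A - B) = card (B - A)"
      using A B by (simp add: bases_def card_Diff_subset_Int Int_commute)
    moreover have "card (A - B) > 0" using x by (auto simp: card_gt_0_iff)
    ultimately have "card (B - A) > 1" using False by linarith
    then have "\<not> B - A \<subseteq> {u. u \<notin> ?Z \<and> insert u ?Z \<in> \<H>}"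
      using order_trans[OF card_mono[OF finite] card_hyperplane_extensions[OF Z]] by (meson leD)
    then obtain y where "y \<in> B - A" "insert y ?Z \<notin> \<H>" by auto
    then show ?thesis using Z by (auto simp: bases_def card_insert_if intro!: bexI[of _ y])
  qed
qed (use bases_nonempty in auto)

lemma circuit_hyperplane:
  assumes "H \<in> \<H>"
  shows "matroid_circuit UNIV bases H"
  unfolding matroid_circuit_def matroid_indep_def
proof (intro conjI allI impI)
  show "\<not> (\<exists>B\<in>bases. H \<subseteq> B)"
  proof
    assume "\<exists>B\<in>bases. H \<subseteq> B"
    then obtain B where "B \<notin> \<H>" "card B = k" "H \<subseteq> B" by (auto simp: bases_def)
    then show False using card_subset_eq[of B H] assms card_hyperplane[OF assms] by simp
  qed
  fix D assume "D \<subset> H"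
  then obtain z where z: "z \<in> H" "D \<subseteq> H - {z}" by blast
  have "card H \<noteq> CARD('n)" using card_hyperplane[OF assms] rank_ge_3 rank_le_half by linarith
  then have "H \<noteq> UNIV" by blast
  then obtain w where "w \<notin> H" by auto
  then have "insert w (H - {z}) \<in> bases"
    using assms z(1) card_hyperplane[OF assms] rank_ge_3
    by (intro insert_in_bases[of _ H]) (auto simp: card_Diff_singleton)
  then show "\<exists>B\<in>bases. D \<subseteq> B" using z by blast
qed simp

text \<open>The circuit is sought inside a (k + 1)-set \<open>?C\<close> containing x and y, with u
  chosen such that deleting x or y from \<open>?C\<close> does not leave a member of \<H>. At least
  three candidates for u face at most two bad ones. If \<open>?C\<close> contains a member of \<H>,
  that member is a circuit and still contains x and y; if not, all k-subsets of \<open>?C\<close>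
  are bases and \<open>?C\<close> is itself a circuit.\<close>

lemma matroid_connected_bases: "matroid_connected UNIV bases"
  unfolding matroid_connected_def
proof (intro ballI impI)
  fix x y :: 'n assume xy: "x \<noteq> y"
  have "card (- {x, y}) = CARD('n) - 2" using xy by (simp add: card_Compl)
  moreover have "k - 2 \<le> CARD('n) - 2" using rank_le_half by simp
  ultimately obtain A0 where A0: "A0 \<subseteq> - {x, y}" "card A0 = k - 2"
    by (metis obtain_subset_with_card_n)
  let ?bad = "\<lambda>z. {u. u \<notin> insert z A0 \<and> insert u (insert z A0) \<in> \<H>}"
  let ?V = "- (A0 \<union> {x, y})"
  have V: "card ?V = CARD('n) - k"
    using A0 xy rank_ge_3 by (subst card_Compl) (auto simp: card_insert_if)
  have bad: "card (?bad x) \<le> 1" "card (?bad y) \<le> 1"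
    using A0 rank_ge_3 by (intro card_hyperplane_extensions; auto simp: card_insert_if subset_iff)+
  have "\<not> ?V \<subseteq> ?bad x \<union> ?bad y"
  proof
    assume "?V \<subseteq> ?bad x \<union> ?bad y"
    then have "card ?V \<le> card (?bad x \<union> ?bad y)" by (intro card_mono) auto
    also have "\<dots> \<le> card (?bad x) + card (?bad y)" by (rule card_Un_le)
    also have "\<dots> \<le> 2" using bad by linarith
    finally show False using V rank_ge_3 rank_le_half by simp
  qed
  then obtain u where u: "u \<notin> A0" "u \<noteq> x" "u \<noteq> y"
      "insert u (insert x A0) \<notin> \<H>" "insert u (insert y A0) \<notin> \<H>" by blast
  let ?C = "insert x (insert y (insert u A0))"
  have C: "card ?C = k + 1"
    using u xy A0 rank_ge_3 by (auto simp: card_insert_if subset_iff)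
  show "\<exists>C. matroid_circuit UNIV bases C \<and> x \<in> C \<and> y \<in> C"
  proof (cases "\<exists>H\<in>\<H>. H \<subseteq> ?C")
    case True
    then obtain H where H: "H \<in> \<H>" "H \<subseteq> ?C" by blast
    have "card (?C - H) = 1"
      using H C card_hyperplane[OF H(1)] by (simp add: card_Diff_subset)
    then obtain a where "?C - H = {a}" by (rule card_1_singletonE)
    then have a: "H = ?C - {a}" using H by blast
    have "a \<noteq> x" "a \<noteq> y"
    proof -
      have "?C - {x} = insert u (insert y A0)" "?C - {y} = insert u (insert x A0)"
        using u xy A0(1) by auto
      then show "a \<noteq> x" "a \<noteq> y" using u(4,5) a H(1) by metis+
    qed
    then have "x \<in> H" "y \<in> H" using a by auto
    then show ?thesis using circuit_hyperplane[OF H(1)] by blast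
  next
    case False
    have "matroid_circuit UNIV bases ?C"
      unfolding matroid_circuit_def matroid_indep_def
    proof (intro conjI allI impI)
      show "\<not> (\<exists>B\<in>bases. ?C \<subseteq> B)"
      proof
        assume "\<exists>B\<in>bases. ?C \<subseteq> B"
        then obtain B where "B \<in> bases" "?C \<subseteq> B" by blast
        then have "card ?C \<le> k" using card_mono[of B ?C] by (simp add: bases_def)
        then show False using C by simp
      qed
      fix D assume "D \<subset> ?C"
      then obtain z where z: "z \<in> ?C" "D \<subseteq> ?C - {z}" by blast
      have "card (?C - {z}) = k" using C z(1) by (simp only: card_Diff_singleton)
      moreover have "?C - {z} \<notin> \<H>" using False Diff_subset by metis
      ultimately have "?C - {z} \<in> bases" by (simp add: bases_def)
      then show "\<exists>B\<in>bases. D \<subseteq> B" using z(2) by blast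
    qed simp
    then show ?thesis by blast
  qed
qed

end

section \<open>Facets of the base polytope\<close>

lemma vertex_nth: "(\<Sum>i\<in>B. axis i 1 :: real ^ 'n::finite) $ j = (if j \<in> B then 1 else 0)"
  by (simp add: axis_def if_distrib cong: if_cong)

lemma sum_add_sum_Compl: "sum f A + sum f (- A) = sum f (UNIV :: 'a::finite set)"
  using sum.union_disjoint[of A "- A" f] by (simp add: Compl_partition)

context sparse_paving
begin

definition polytope_H :: "(real ^ 'n) set" where
  "polytope_H = {x. (\<forall>i. 0 \<le> x $ i \<and> x $ i \<le> 1) \<and> (\<Sum>i\<in>UNIV. x $ i) = real k \<and>
     (\<forall>H\<in>\<H>. (\<Sum>i\<in>H. x $ i) \<le> real k - 1)}"

lemma convex_polytope_H: "convex polytope_H"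
proof (rule convexI)
  fix x y and u v :: real
  assume *: "x \<in> polytope_H" "y \<in> polytope_H" "0 \<le> u" "0 \<le> v" "u + v = 1"
  have lin: "(\<Sum>i\<in>A. (u *\<^sub>R x + v *\<^sub>R y) $ i) = u * (\<Sum>i\<in>A. x $ i) + v * (\<Sum>i\<in>A. y $ i)" for A
    by (simp add: sum.distrib sum_distrib_left)
  show "u *\<^sub>R x + v *\<^sub>R y \<in> polytope_H"
    unfolding polytope_H_def mem_Collect_eq
  proof (intro conjI allI ballI)
    show "(\<Sum>i\<in>UNIV. (u *\<^sub>R x + v *\<^sub>R y) $ i) = real k"
      using * unfolding lin by (simp add: polytope_H_def flip: distrib_right)
    show "(\<Sum>i\<in>H. (u *\<^sub>R x + v *\<^sub>R y) $ i) \<le> real k - 1" if "H \<in> \<H>" for H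
      using * that unfolding lin by (intro convex_bound_le) (auto simp: polytope_H_def)
    show "0 \<le> (u *\<^sub>R x + v *\<^sub>R y) $ i" for i
      using * by (simp add: polytope_H_def)
    show "(u *\<^sub>R x + v *\<^sub>R y) $ i \<le> 1" for i
      using * by (auto simp: polytope_H_def intro!: convex_bound_le)
  qed
qed

lemma compact_polytope_H: "compact polytope_H"
proof -
  have "polytope_H = cbox 0 1 \<inter> {x. (\<Sum>i\<in>UNIV. x $ i) = real k} \<inter>
      (\<Inter>H\<in>\<H>. {x. (\<Sum>i\<in>H. x $ i) \<le> real k - 1})"
    by (auto simp: polytope_H_def mem_box_cart)
  moreover have "closed {x :: real ^ 'n. (\<Sum>i\<in>UNIV. x $ i) = real k}"
    by (intro closed_Collect_eq continuous_intros)
  moreover have "closed {x :: real ^ 'n. (\<Sum>i\<in>H. x $ i) \<le> real k - 1}" for H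
    by (intro closed_Collect_le continuous_intros)
  ultimately show ?thesis by (auto intro!: compact_Int_closed closed_INT)
qed

text \<open>The deficits 1 - x on \<open>H \<inter> K\<close> and the values of x outside
  \<open>H \<union> K\<close> are nonnegative and add up to |H \<inter> K| + 2 - k, which is at most
  0. So a fractional coordinate lies in exactly one of two tight sets.\<close>

lemma two_tight:
  assumes x: "x \<in> polytope_H" and HK: "H \<in> \<H>" "K \<in> \<H>" "H \<noteq> K"
    and tight: "(\<Sum>i\<in>H. x $ i) = real k - 1" "(\<Sum>i\<in>K. x $ i) = real k - 1"
  shows "i \<in> H \<inter> K \<Longrightarrow> x $ i = 1" "i \<notin> H \<union> K \<Longrightarrow> x $ i = 0"
proof -
  have bd: "0 \<le> x $ i" "x $ i \<le> 1" for i using x by (auto simp: polytope_H_def)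
  have total: "(\<Sum>i\<in>H \<union> K. x $ i) + (\<Sum>i\<in>-(H \<union> K). x $ i) = real k"
    unfolding sum_add_sum_Compl using x by (simp add: polytope_H_def)
  have inter: "(\<Sum>i\<in>H \<inter> K. x $ i) = 2 * (real k - 1) - (\<Sum>i\<in>H \<union> K. x $ i)"
    using tight sum.union_inter[of "H" K "\<lambda>i. x $ i"] by simp
  have "(\<Sum>i\<in>H \<inter> K. 1 - x $ i) + (\<Sum>i\<in>-(H \<union> K). x $ i) = real (card (H \<inter> K)) + 2 - real k"
    using total inter by (simp add: sum_subtractf)
  moreover have "real (card (H \<inter> K)) + 2 \<le> real k"
    using card_Int_hyperplanes[OF HK] by linarith
  moreover have "(\<Sum>i\<in>H \<inter> K. 1 - x $ i) \<ge> 0" "(\<Sum>i\<in>-(H \<union> K). x $ i) \<ge> 0"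
    using bd by (auto intro!: sum_nonneg)
  ultimately have "(\<Sum>i\<in>H \<inter> K. 1 - x $ i) = 0" "(\<Sum>i\<in>-(H \<union> K). x $ i) = 0"
    by linarith+
  then show "i \<in> H \<inter> K \<Longrightarrow> x $ i = 1" "i \<notin> H \<union> K \<Longrightarrow> x $ i = 0"
    using bd by (auto simp: sum_nonneg_eq_0_iff )
qed

lemma second_fractional:
  fixes x :: "real ^ 'n"
  assumes "\<And>i. 0 \<le> x $ i \<and> x $ i \<le> 1" "(\<Sum>i\<in>A. x $ i) \<in> \<int>" "i \<in> A" "0 < x $ i" "x $ i < 1"
  shows "\<exists>j\<in>A. j \<noteq> i \<and> 0 < x $ j \<and> x $ j < 1"
proof (rule ccontr)
  assume none: "\<not> ?thesis"
  have "x $ j = 0 \<or> x $ j = 1" if "j \<in> A - {i}" for j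
    using that assms(1)[of j] none by (auto simp: less_eq_real_def)
  then have "(\<Sum>j\<in>A - {i}. x $ j) \<in> \<int>" by (intro Ints_sum) (metis Ints_0 Ints_1)
  moreover have "(\<Sum>j\<in>A. x $ j) = x $ i + (\<Sum>j\<in>A - {i}. x $ j)"
    using assms(3) by (simp add: sum.remove)
  ultimately have "x $ i \<in> \<int>" using assms(2) by (metis Ints_diff add_diff_cancel_right')
  then obtain m :: int where "x $ i = of_int m" by (auto elim: Ints_cases)
  then show False using assms(4,5) by simp
qed

text \<open>If \<open>H\<close> is tight, then x sums to k - 1 on \<open>H\<close> and to 1 on its
  complement. Both are integers, so the side containing i has a second fractional coordinate j. Any
  other tight set agrees with the complement of \<open>H\<close> on fractional coordinates, by
  \<open>two_tight\<close>, and so does not separate i from j either.\<close>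

lemma exchangeable_fractional:
  assumes x: "x \<in> polytope_H" and i: "0 < x $ i" "x $ i < 1"
  obtains i j where "i \<noteq> j" "0 < x $ i" "x $ i < 1" "0 < x $ j" "x $ j < 1"
    "\<And>H. H \<in> \<H> \<Longrightarrow> (\<Sum>i\<in>H. x $ i) = real k - 1 \<Longrightarrow> i \<in> H \<longleftrightarrow> j \<in> H"
proof (cases "\<exists>H\<in>\<H>. (\<Sum>i\<in>H. x $ i) = real k - 1")
  case False
  have "(\<Sum>i\<in>UNIV. x $ i) \<in> \<int>" using x by (simp add: polytope_H_def)
  then obtain j where "j \<noteq> i" "0 < x $ j" "x $ j < 1"
    using second_fractional[of x UNIV i] x i by (auto simp: polytope_H_def)
  then show ?thesis using that[of i j] i False by blast
next
  case True
  then obtain H where H: "H \<in> \<H>" "(\<Sum>i\<in>H. x $ i) = real k - 1" by blast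
  have "(\<Sum>i\<in>H. x $ i) + (\<Sum>i\<in>-H. x $ i) = real k"
    unfolding sum_add_sum_Compl using x by (simp add: polytope_H_def)
  then have "(\<Sum>i\<in>-H. x $ i) = 1" using H by simp
  then have ints: "(\<Sum>i\<in>H. x $ i) \<in> \<int>" "(\<Sum>i\<in>-H. x $ i) \<in> \<int>"
    by (simp_all only: H Ints_diff Ints_1 Ints_of_nat)
  define A where "A = (if i \<in> H then H else - H)"
  have A: "(\<Sum>i\<in>A. x $ i) \<in> \<int>" "i \<in> A" using ints by (auto simp: A_def)
  obtain j where j: "j \<in> A" "j \<noteq> i" "0 < x $ j" "x $ j < 1"
    using second_fractional[of x A i] x A i by (auto simp: polytope_H_def)
  have "i \<in> K \<longleftrightarrow> j \<in> K" if K: "K \<in> \<H>" "(\<Sum>i\<in>K. x $ i) = real k - 1" for K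
  proof (cases "K = H")
    case True
    then show ?thesis using j(1) by (auto simp: A_def split: if_splits)
  next
    case False
    have "l \<in> K \<longleftrightarrow> l \<notin> H" if "0 < x $ l" "x $ l < 1" for l
      using two_tight[OF x H(1) K(1) _ H(2) K(2), of l] that False by fastforce
    then show ?thesis using i j by (auto simp: A_def split: if_splits)
  qed
  then show ?thesis using that[of i j] i j by auto
qed

lemma extreme_point_integral:
  assumes ext: "x extreme_point_of polytope_H"
  shows "x $ l = 0 \<or> x $ l = 1"
proof (rule ccontr)
  assume l: "\<not> ?thesis"
  have x: "x \<in> polytope_H" using ext by (simp add: extreme_point_of_def)
  then have "0 < x $ l" "x $ l < 1" using l by (auto simp: polytope_H_def less_eq_real_def)
  then obtain i j where ij: "i \<noteq> j" "0 < x $ i" "x $ i < 1" "0 < x $ j" "x $ j < 1"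
    and tight: "\<And>H. H \<in> \<H> \<Longrightarrow> (\<Sum>i\<in>H. x $ i) = real k - 1 \<Longrightarrow> i \<in> H \<longleftrightarrow> j \<in> H"
    using exchangeable_fractional[OF x] by metis
  \<comment> \<open>Moving along \<open>d\<close> preserves the total and every tight sum, by the
    choice of \<open>i\<close> and \<open>j\<close>. Strict constraints survive small steps of
    either sign, hence the two-sided filter \<open>nhds 0\<close>.\<close>
  define d :: "real ^ 'n" where "d = axis i 1 - axis j 1"
  have sum_d: "(\<Sum>l\<in>A. d $ l) = of_bool (i \<in> A) - of_bool (j \<in> A)" for A
    by (simp add: d_def sum_subtractf axis_def)
  have sum_s: "(\<Sum>l\<in>A. (x + s *\<^sub>R d) $ l) = (\<Sum>l\<in>A. x $ l) + s * (\<Sum>l\<in>A. d $ l)" for A s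
    by (simp add: sum.distrib sum_distrib_left)
  have ev1: "\<forall>\<^sub>F s in nhds 0. 0 \<le> (x + s *\<^sub>R d) $ l \<and> (x + s *\<^sub>R d) $ l \<le> 1" for l
  proof (cases "l = i \<or> l = j")
    case True
    then have "0 < x $ l + 0 * d $ l" "x $ l + 0 * d $ l < 1" using ij by auto
    moreover have "((\<lambda>s. x $ l + s * d $ l) \<longlongrightarrow> x $ l + 0 * d $ l) (nhds 0)"
      by (intro tendsto_intros filterlim_ident)
    ultimately have "\<forall>\<^sub>F s in nhds 0. 0 < x $ l + s * d $ l" "\<forall>\<^sub>F s in nhds 0. x $ l + s * d $ l < 1"
      by (auto intro: order_tendstoD)
    then show ?thesis by eventually_elim simp
  next
    case False
    then show ?thesis using x by (simp add: d_def axis_def polytope_H_def)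
  qed
  have ev2: "\<forall>\<^sub>F s in nhds 0. (\<Sum>l\<in>H. (x + s *\<^sub>R d) $ l) \<le> real k - 1" if "H \<in> \<H>" for H
  proof (cases "(\<Sum>l\<in>H. x $ l) = real k - 1")
    case True
    then show ?thesis unfolding sum_s sum_d using tight[OF that] by simp
  next
    case False
    then have "(\<Sum>l\<in>H. x $ l) + 0 * (\<Sum>l\<in>H. d $ l) < real k - 1"
      using x that by (auto simp: polytope_H_def less_eq_real_def)
    moreover have "((\<lambda>s. (\<Sum>l\<in>H. x $ l) + s * (\<Sum>l\<in>H. d $ l)) \<longlongrightarrow>
        (\<Sum>l\<in>H. x $ l) + 0 * (\<Sum>l\<in>H. d $ l)) (nhds 0)"
      by (intro tendsto_intros filterlim_ident)
    ultimately have "\<forall>\<^sub>F s in nhds 0. (\<Sum>l\<in>H. x $ l) + s * (\<Sum>l\<in>H. d $ l) < real k - 1"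
      by (auto intro: order_tendstoD)
    then show ?thesis unfolding sum_s by eventually_elim simp
  qed
  have "\<forall>\<^sub>F s in nhds 0. (\<forall>l. 0 \<le> (x + s *\<^sub>R d) $ l \<and> (x + s *\<^sub>R d) $ l \<le> 1) \<and>
      (\<forall>H\<in>\<H>. (\<Sum>l\<in>H. (x + s *\<^sub>R d) $ l) \<le> real k - 1)"
    by (rule eventually_conj[OF eventually_all_finite[OF ev1] eventually_ball_finite]) (use ev2 in auto)
  moreover have "(\<Sum>l\<in>UNIV. (x + s *\<^sub>R d) $ l) = real k" for s
    unfolding sum_s sum_d using x by (simp add: polytope_H_def)
  ultimately have "\<forall>\<^sub>F s in nhds 0. x + s *\<^sub>R d \<in> polytope_H"
    by (simp add: polytope_H_def del: vector_add_component vector_scaleR_component)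
  then obtain e where e: "e > 0" "\<And>s. dist s 0 < e \<Longrightarrow> x + s *\<^sub>R d \<in> polytope_H"
    unfolding eventually_nhds_metric by blast
  have mem: "x - (e / 2) *\<^sub>R d \<in> polytope_H" "x + (e / 2) *\<^sub>R d \<in> polytope_H"
    using e(1) e(2)[of "e / 2"] e(2)[of "- (e / 2)"] by auto
  have "d $ i = 1" using ij by (simp add: d_def axis_def)
  then have "d \<noteq> 0" by auto
  then have "x - (e / 2) *\<^sub>R d \<noteq> x + (e / 2) *\<^sub>R d"
    using e(1) by (simp add: diff_eq_eq add.assoc flip: scaleR_add_left)
  moreover have "midpoint (x - (e / 2) *\<^sub>R d) (x + (e / 2) *\<^sub>R d) = x"
    by (simp add: midpoint_def flip: scaleR_add_left)
  ultimately have "x \<in> open_segment (x - (e / 2) *\<^sub>R d) (x + (e / 2) *\<^sub>R d)"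
    by (metis midpoint_in_open_segment)
  then show False using ext mem by (auto simp: extreme_point_of_def)
qed

text \<open>One inclusion holds because a basis misses a point of each member of \<H>. For the
  other, a compact convex set is the hull of its extreme points, and a 0-1 point of
  \<open>polytope_H\<close> is the indicator of a basis.\<close>

lemma base_polytope_bases: "base_polytope bases = polytope_H"
proof
  have "(\<Sum>i\<in>B. axis i 1) \<in> polytope_H" if "B \<in> bases" for B
    unfolding polytope_H_def mem_Collect_eq vertex_nth
  proof (intro conjI allI ballI)
    show "(\<Sum>i\<in>UNIV. if i \<in> B then 1 else 0) = real k"
      using that by (simp add: bases_def sum.If_cases)
    fix H assume H: "H \<in> \<H>"
    have "\<not> H \<subseteq> B"
      using H that card_hyperplane[OF H] card_subset_eq[of B H] by (auto simp: bases_def)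
    then have "card (H \<inter> B) < card H" by (intro psubset_card_mono) auto
    then show "(\<Sum>i\<in>H. if i \<in> B then 1 else 0) \<le> real k - 1"
      using card_hyperplane[OF H] by (simp flip: sum.inter_filter) (simp add: Int_def)
  qed auto
  then show "base_polytope bases \<subseteq> polytope_H"
    unfolding base_polytope_def by (intro hull_minimal convex_polytope_H) auto
  have "x \<in> (\<lambda>B. \<Sum>i\<in>B. axis i 1) ` bases" if "x extreme_point_of polytope_H" for x
  proof -
    define B where "B = {i. x $ i = 1}"
    have xB: "x $ i = (if i \<in> B then 1 else 0)" for i
      using extreme_point_integral[OF that, of i] by (auto simp: B_def)
    have x: "x \<in> polytope_H" using that by (simp add: extreme_point_of_def)
    have "real (card B) = real k" using x by (simp add: polytope_H_def xB sum.If_cases)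
    moreover have "B \<notin> \<H>"
    proof
      assume "B \<in> \<H>"
      then have "(\<Sum>i\<in>B. x $ i) \<le> real k - 1" using x by (simp add: polytope_H_def)
      then show False using \<open>real (card B) = real k\<close> by (simp add: xB)
    qed
    ultimately have "B \<in> bases" by (simp add: bases_def)
    moreover have "x = (\<Sum>i\<in>B. axis i 1)"
      unfolding vec_eq_iff vertex_nth xB by simp
    ultimately show ?thesis by blast
  qed
  then have "convex hull {x. x extreme_point_of polytope_H} \<subseteq> base_polytope bases"
    unfolding base_polytope_def by (intro hull_mono) blast
  then show "polytope_H \<subseteq> base_polytope bases"
    using Krein_Milman_Minkowski[OF compact_polytope_H convex_polytope_H] by simp
qed

text \<open>Values in \<open>nat\<close> build in nonnegativity, and scaling the bounds by t avoids
  division, so t = 0 is not exceptional here.\<close>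

definition lattice_points :: "nat \<Rightarrow> ('n \<Rightarrow> nat) set" where
  "lattice_points t = {g. (\<forall>i. g i \<le> t) \<and> sum g UNIV = t * k \<and> (\<forall>H\<in>\<H>. sum g H \<le> t * (k - 1))}"

lemma card_integer_points:
  "card ((\<lambda>x. real t *\<^sub>R x) ` base_polytope bases \<inter> integer_points) = card (lattice_points t)"
proof -
  let ?v = "\<lambda>g :: 'n \<Rightarrow> nat. \<chi> i. real (g i)"
  have "(\<lambda>x. real t *\<^sub>R x) ` polytope_H \<inter> integer_points = ?v ` lattice_points t"
  proof (intro equalityI subsetI)
    fix y assume "y \<in> (\<lambda>x. real t *\<^sub>R x) ` polytope_H \<inter> integer_points"
    then obtain x where x: "x \<in> polytope_H" "y = real t *\<^sub>R x" and int: "\<And>i. y $ i \<in> \<int>"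
      by (auto simp: integer_points_def)
    have y0: "0 \<le> y $ i" "y $ i \<le> real t" for i
      using x by (auto simp: polytope_H_def mult_left_le)
    define g where "g i = nat \<lfloor>y $ i\<rfloor>" for i
    have g: "real (g i) = y $ i" for i
      using y0[of i] int[of i] by (auto simp: g_def elim!: Ints_cases)
    have sums: "real (sum g A) = real t * (\<Sum>i\<in>A. x $ i)" for A
      by (simp add: g x sum_distrib_left)
    have "real (g i) \<le> real t" for i using y0 by (simp add: g)
    moreover have "real (sum g UNIV) = real (t * k)"
      unfolding sums using x by (simp add: polytope_H_def)
    moreover have "real (sum g H) \<le> real (t * (k - 1))" if "H \<in> \<H>" for H
      unfolding sums using x that rank_ge_3 by (auto simp: polytope_H_def of_nat_diff intro!: mult_left_mono)
    ultimately have "g \<in> lattice_points t"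
      unfolding lattice_points_def by (simp only: of_nat_le_iff of_nat_eq_iff mem_Collect_eq) blast
    moreover have "y = ?v g" by (simp add: vec_eq_iff g)
    ultimately show "y \<in> ?v ` lattice_points t" by blast
  next
    fix y assume "y \<in> ?v ` lattice_points t"
    then obtain g where g: "g \<in> lattice_points t" "y = ?v g" by blast
    have "y \<in> integer_points" by (simp add: g integer_points_def)
    moreover have "y \<in> (\<lambda>x. real t *\<^sub>R x) ` polytope_H"
    \<comment> \<open>For t = 0 the point cannot be scaled back; the dilate contains 0 because the
      polytope is nonempty.\<close>
    proof (cases "t = 0")
      case True
      then have "y = 0" using g by (simp add: lattice_points_def vec_eq_iff)
      moreover have "polytope_H \<noteq> {}"
        using bases_nonempty base_polytope_bases by (auto simp: base_polytope_def)
      ultimately show ?thesis using True by auto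
    next
      case False
      have sums: "(\<Sum>i\<in>A. (inverse (real t) *\<^sub>R y) $ i) = real (sum g A) / real t" for A
        by (simp add: g sum_distrib_left divide_inverse mult.commute)
      have "inverse (real t) *\<^sub>R y \<in> polytope_H"
        unfolding polytope_H_def mem_Collect_eq sums
      proof (intro conjI allI ballI)
        show "real (sum g UNIV) / real t = real k" using g False by (simp add: lattice_points_def)
        fix H assume "H \<in> \<H>"
        then have "real (sum g H) \<le> real (t * (k - 1))"
          using g by (simp only: of_nat_le_iff lattice_points_def mem_Collect_eq)
        then show "real (sum g H) / real t \<le> real k - 1"
          using False rank_ge_3 by (simp add: field_simps of_nat_diff)
      qed (use g False in \<open>auto simp: lattice_points_def field_simps\<close>)
      then show ?thesis using False by (intro image_eqI[of _ _ "inverse (real t) *\<^sub>R y"]) auto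
    qed
    ultimately show "y \<in> (\<lambda>x. real t *\<^sub>R x) ` polytope_H \<inter> integer_points" by blast
  qed
  moreover have "inj_on ?v (lattice_points t)" by (auto simp: inj_on_def vec_eq_iff)
  ultimately show ?thesis by (simp add: base_polytope_bases card_image)
qed

lemma rank_sq_less: "k * k < (k - 1) * CARD('n)"
proof -
  have "k * k < k * (2 * (k - 1))" using rank_ge_3 by (intro mult_strict_left_mono) auto
  also have "\<dots> = (k - 1) * (2 * k)" by simp
  also have "\<dots> \<le> (k - 1) * CARD('n)" using rank_le_half by (intro mult_le_mono2)
  finally show ?thesis .
qed

text \<open>The barycentre, with all coordinates k / n, satisfies every inequality strictly. An open
  set meeting the hyperplane \<open>A\<close> at this point cuts out a piece of full dimension in
  \<open>A\<close>.\<close>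

lemma aff_dim_base_polytope: "aff_dim (base_polytope bases) = int CARD('n) - 1"
proof -
  define A where "A = {x :: real ^ 'n. (\<chi> i. 1) \<bullet> x = real k}"
  define T where "T = (\<Inter>i. {x :: real ^ 'n. 0 < x $ i} \<inter> {x. x $ i < 1}) \<inter>
    (\<Inter>H\<in>\<H>. {x. (\<Sum>i\<in>H. x $ i) < real k - 1})"
  have sum: "(\<chi> i. 1) \<bullet> x = (\<Sum>i\<in>UNIV. x $ i)" for x :: "real ^ 'n" by (simp add: inner_vec_def)
  have A: "aff_dim A = int CARD('n) - 1"
    unfolding A_def by (subst aff_dim_hyperplane) (auto simp: vec_eq_iff)
  have "open {x :: real ^ 'n. (\<Sum>i\<in>H. x $ i) < real k - 1}" for H
    by (intro open_Collect_less continuous_intros)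
  moreover have "open {x :: real ^ 'n. 0 < x $ i}" "open {x :: real ^ 'n. x $ i < 1}" for i
    by (intro open_Collect_less continuous_intros)+
  ultimately have "open T" unfolding T_def by (intro open_Int open_INT) auto
  moreover have "(\<chi> i. real k / real CARD('n)) \<in> A \<inter> T"
  proof -
    have "real (k * k) < real ((k - 1) * CARD('n))" using rank_sq_less by (simp only: of_nat_less_iff)
    then have "real (card H) * (real k / real CARD('n)) < real k - 1" if "H \<in> \<H>" for H
      using card_hyperplane[OF that] rank_ge_3 by (simp add: field_simps of_nat_diff)
    then show ?thesis using rank_ge_3 rank_le_half by (auto simp: A_def T_def sum)
  qed
  ultimately have "aff_dim (A \<inter> T) = aff_dim A"
    by (intro aff_dim_convex_Int_open) (auto simp: A_def convex_hyperplane)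
  moreover have "A \<inter> T \<subseteq> polytope_H" by (auto simp: A_def T_def sum polytope_H_def less_imp_le)
  moreover have "polytope_H \<subseteq> A" by (auto simp: A_def sum polytope_H_def)
  ultimately show ?thesis
    unfolding base_polytope_bases using A aff_dim_subset by (metis order_antisym)
qed

end

section \<open>Counting lattice points\<close>

lemma sum_update:
  fixes g :: "'a::finite \<Rightarrow> nat"
  shows "(\<Sum>x\<in>A. if x = i then r else g x) = (if i \<in> A then r + sum g (A - {i}) else sum g A)"
proof (cases "i \<in> A")
  case True
  then have "(\<Sum>x\<in>A. if x = i then r else g x) = r + (\<Sum>x\<in>A - {i}. if x = i then r else g x)"
    by (simp add: sum.remove)
  also have "(\<Sum>x\<in>A - {i}. if x = i then r else g x) = sum g (A - {i})" by (intro sum.cong) auto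
  finally show ?thesis using True by simp
next
  case False
  then show ?thesis by (auto intro!: sum.cong)
qed

lemma finite_bounded_functions: "finite {g :: 'a::finite \<Rightarrow> nat. \<forall>i. g i \<le> s}"
proof -
  have "{g :: 'a \<Rightarrow> nat. \<forall>i. g i \<le> s} = (UNIV \<rightarrow>\<^sub>E {..s})" by (auto simp: PiE_def extensional_def)
  then show ?thesis by (simp add: finite_PiE)
qed

text \<open>Weak compositions of s with parts indexed by \<open>A\<close>. Vanishing outside
  \<open>A\<close> gives each of them a unique total function.\<close>

definition compositions :: "'a::finite set \<Rightarrow> nat \<Rightarrow> ('a \<Rightarrow> nat) set" where
  "compositions A s = {g. (\<forall>i. i \<notin> A \<longrightarrow> g i = 0) \<and> sum g A = s}"

lemma finite_compositions: "finite (compositions A s)"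
proof (rule finite_subset[OF _ finite_bounded_functions])
  show "compositions A s \<subseteq> {g. \<forall>i. g i \<le> s}"
  proof clarify
    fix g i assume g: "g \<in> compositions A s"
    show "g i \<le> s"
    proof (cases "i \<in> A")
      case True
      then show ?thesis using g member_le_sum[of i A g] by (simp add: compositions_def)
    qed (use g in \<open>simp add: compositions_def\<close>)
  qed
qed

lemma compositions_insert:
  assumes "i \<notin> A"
  shows "compositions (insert i A) s = (\<Union>r\<le>s. (\<lambda>g. g(i := s - r)) ` compositions A r)"
proof (intro equalityI subsetI)
  fix g assume g: "g \<in> compositions (insert i A) s"
  then have s: "g i + sum g A = s" using assms by (simp add: compositions_def)
  have "g(i := 0) \<in> compositions A (sum g A)"
    using g assms by (auto simp: compositions_def sum_update fun_upd_def)
  moreover have "g = (g(i := 0))(i := s - sum g A)" using s by (auto simp: fun_eq_iff)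
  ultimately show "g \<in> (\<Union>r\<le>s. (\<lambda>g. g(i := s - r)) ` compositions A r)"
    using s by (intro UN_I[of "sum g A"] image_eqI[of _ _ "g(i := 0)"]) auto
next
  fix g assume "g \<in> (\<Union>r\<le>s. (\<lambda>g. g(i := s - r)) ` compositions A r)"
  then show "g \<in> compositions (insert i A) s"
    using assms by (auto simp: compositions_def sum_update fun_upd_def)
qed

text \<open>Stars and bars. Splitting off one coordinate leaves a sum along a diagonal of Pascal's
  triangle.\<close>

lemma card_compositions:
  assumes "card A = Suc a"
  shows "card (compositions A s) = (s + a) choose a"
  using assms
proof (induction a arbitrary: A s)
  case 0
  then obtain i where "A = {i}" by (metis One_nat_def card_1_singletonE)
  then have "compositions A s = {(\<lambda>_. 0)(i := s)}" by (auto simp: compositions_def fun_eq_iff)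
  then show ?case by simp
next
  case (Suc a)
  then obtain i B where iB: "A = insert i B" "i \<notin> B" "card B = Suc a"
    by (metis card_Suc_eq)
  have "inj_on (\<lambda>g. g(i := s - r)) (compositions B r)" for r
  proof (rule inj_onI)
    fix g h assume gh: "g \<in> compositions B r" "h \<in> compositions B r" "g(i := s - r) = h(i := s - r)"
    have "g i = h i" using gh(1,2) iB by (simp add: compositions_def)
    then show "g = h" using gh(3) by (metis fun_upd_triv fun_upd_upd)
  qed
  then have im: "card ((\<lambda>g. g(i := s - r)) ` compositions B r) = (r + a) choose a" for r
    by (simp add: card_image Suc.IH iB)
  have total: "sum g B = r" if "g \<in> (\<lambda>g. g(i := s - r)) ` compositions B r" for g r
    using that iB by (auto simp: compositions_def sum_update fun_upd_def)
  then have "card (compositions A s) = (\<Sum>r\<le>s. card ((\<lambda>g. g(i := s - r)) ` compositions B r))"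
    unfolding iB(1) compositions_insert[OF iB(2)]
    using total by (intro card_UN_disjoint ballI impI; simp add: finite_compositions disjoint_iff) metis
  also have "\<dots> = (\<Sum>r\<le>s. (a + r) choose a)" by (simp add: im add.commute)
  also have "\<dots> = (s + Suc a) choose Suc a" by (subst choose_rising_sum(1)) (simp add: add.commute add.left_commute)
  finally show ?case .
qed

lemma card_split_compositions:
  fixes A :: "'a::finite set"
  assumes "card A = Suc a" "card (- A) = Suc b"
  shows "card {g. sum g A = r \<and> sum g (- A) = s} = ((r + a) choose a) * ((s + b) choose b)"
    and "finite {g. sum g A = r \<and> sum g (- A) = s}"
proof -
  let ?f = "\<lambda>(g, h). \<lambda>i. g i + h i :: nat"
  let ?S = "{g. sum g A = r \<and> sum g (- A) = s}"
  have "bij_betw ?f (compositions A r \<times> compositions (- A) s) ?S"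
  proof (rule bij_betw_byWitness[where f' = "\<lambda>g. (\<lambda>i. if i \<in> A then g i else 0, \<lambda>i. if i \<in> A then 0 else g i)"])
    show "\<forall>p\<in>compositions A r \<times> compositions (- A) s.
        (\<lambda>i. if i \<in> A then ?f p i else 0, \<lambda>i. if i \<in> A then 0 else ?f p i) = p"
      by (auto simp: compositions_def fun_eq_iff)
    show "?f ` (compositions A r \<times> compositions (- A) s) \<subseteq> ?S"
      by (auto simp: compositions_def sum.distrib)
    show "(\<lambda>g. (\<lambda>i. if i \<in> A then g i else 0, \<lambda>i. if i \<in> A then 0 else g i)) ` ?S
        \<subseteq> compositions A r \<times> compositions (- A) s"
      by (auto simp: compositions_def intro!: sum.cong)
  qed (auto simp: fun_eq_iff)
  from bij_betw_same_card[OF this] bij_betw_finite[OF this]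
  show "card ?S = ((r + a) choose a) * ((s + b) choose b)" "finite ?S"
    using assms by (simp_all add: card_cartesian_product card_compositions finite_compositions)
qed

text \<open>An integer total lets a negative total stand for the empty set.\<close>

definition capped :: "nat \<Rightarrow> 'a::finite set \<Rightarrow> int \<Rightarrow> ('a \<Rightarrow> nat) set" where
  "capped t C s = {g. int (sum g UNIV) = s \<and> (\<forall>i\<in>C. g i \<le> t)}"

text \<open>The number of uncapped functions with total s on a + 1 coordinates. Negative totals need
  their own case, since \<open>nat\<close> would turn them into 0 and count one function.\<close>

definition free_count :: "nat \<Rightarrow> int \<Rightarrow> int" where
  "free_count a s = (if s < 0 then 0 else int ((nat s + a) choose a))"

lemma capped_empty: "capped t {} (int s) = compositions UNIV s"
  by (auto simp: capped_def compositions_def simp del: of_nat_sum)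

lemma finite_capped: "finite (capped t C s)"
proof (cases "s < 0")
  case True
  then have "capped t C s = {}" by (auto simp: capped_def simp del: of_nat_sum)
  then show ?thesis by simp
next
  case False
  then have "capped t C s \<subseteq> compositions UNIV (nat s)" by (auto simp: capped_def compositions_def simp del: of_nat_sum)
  then show ?thesis using finite_compositions finite_subset by blast
qed

text \<open>Subtracting t + 1 at i is a bijection from the functions that break the new cap onto
  functions with a smaller total and no cap at i.\<close>

lemma card_capped_insert:
  assumes "i \<notin> C"
  shows "int (card (capped t (insert i C) s)) = int (card (capped t C s)) - int (card (capped t C (s - int (t + 1))))"
proof -
  let ?up = "\<lambda>g. g(i := g i + (t + 1))"
  have eq: "capped t C s = capped t (insert i C) s \<union> ?up ` capped t C (s - int (t + 1))"
  proof (intro equalityI subsetI)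
    fix g assume g: "g \<in> capped t C s"
    show "g \<in> capped t (insert i C) s \<union> ?up ` capped t C (s - int (t + 1))"
    proof (cases "g i \<le> t")
      case False
      let ?h = "g(i := g i - (t + 1))"
      have "sum g UNIV = g i + sum g (UNIV - {i})" by (simp add: sum.remove)
      then have "?h \<in> capped t C (s - int (t + 1))"
        using g False assms by (auto simp: capped_def sum_update fun_upd_def simp del: of_nat_sum)
      moreover have "g = ?up ?h" using False by (auto simp: fun_eq_iff)
      ultimately show ?thesis by blast
    qed (use g in \<open>auto simp: capped_def simp del: of_nat_sum\<close>)
  next
    fix g assume "g \<in> capped t (insert i C) s \<union> ?up ` capped t C (s - int (t + 1))"
    moreover have "sum h UNIV = h i + sum h (UNIV - {i})" for h :: "'a \<Rightarrow> nat" by (simp add: sum.remove)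
    ultimately show "g \<in> capped t C s"
      using assms by (auto simp: capped_def sum_update fun_upd_def simp del: of_nat_sum)
  qed
  have inj: "inj ?up"
  proof (rule injI)
    fix g h assume gh: "?up g = ?up h"
    then have "g i = h i" by (metis add_right_cancel fun_upd_same)
    then show "g = h" using gh by (metis fun_upd_triv fun_upd_upd)
  qed
  have "card (capped t C s) = card (capped t (insert i C) s) + card (?up ` capped t C (s - int (t + 1)))"
    by (subst eq, rule card_Un_disjoint) (auto simp: finite_capped, auto simp: capped_def simp del: of_nat_sum)
  also have "card (?up ` capped t C (s - int (t + 1))) = card (capped t C (s - int (t + 1)))"
    using inj by (intro card_image) (auto intro: inj_on_subset)
  finally show ?thesis by simp
qed

text \<open>Inclusion-exclusion over the broken caps, obtained by imposing one cap at a time;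
  Pascal's rule merges the two sums.\<close>

lemma card_capped:
  assumes "CARD('n::finite) = Suc a"
  shows "int (card (capped t (C :: 'n set) s)) =
    (\<Sum>j\<le>card C. (-1) ^ j * int (card C choose j) * free_count a (s - int j * int (t + 1)))"
proof (induction C arbitrary: s rule: finite_induct[OF finite])
  case 1
  show ?case
  proof (cases "s < 0")
    case True
    then have "capped t ({} :: 'n set) s = {}" by (auto simp: capped_def simp del: of_nat_sum)
    then show ?thesis using True by (simp add: free_count_def)
  next
    case False
    then show ?thesis
      using capped_empty[of t "nat s", where 'a = 'n] assms by (simp add: free_count_def card_compositions)
  qed
next
  case (2 i C)
  let ?m = "card C"
  define f where "f j = free_count a (s - int j * int (t + 1))" for j
  have shift: "free_count a (s - int (t + 1) - int j * int (t + 1)) = f (Suc j)" for j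
    by (simp add: f_def algebra_simps)
  have "(\<Sum>j\<le>Suc ?m. (-1) ^ j * int (Suc ?m choose j) * f j)
      = f 0 + (\<Sum>j\<le>?m. (-1) ^ Suc j * int (Suc ?m choose Suc j) * f (Suc j))"
    by (subst sum.atMost_Suc_shift) simp
  also have "\<dots> = f 0 + (\<Sum>j\<le>?m. (-1) ^ Suc j * int (?m choose Suc j) * f (Suc j))
      - (\<Sum>j\<le>?m. (-1) ^ j * int (?m choose j) * f (Suc j))"
    unfolding add_diff_eq [symmetric] sum_subtractf [symmetric]
    by (intro arg_cong2[of _ _ _ _ "(+)"] sum.cong refl) (simp add: algebra_simps)
  also have "f 0 + (\<Sum>j\<le>?m. (-1) ^ Suc j * int (?m choose Suc j) * f (Suc j))
      = (\<Sum>j\<le>Suc ?m. (-1) ^ j * int (?m choose j) * f j)"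
    by (subst sum.atMost_Suc_shift) simp
  also have "\<dots> = (\<Sum>j\<le>?m. (-1) ^ j * int (?m choose j) * f j)" by simp
  finally show ?case
    unfolding card_capped_insert[OF 2(2)] 2(3) shift card_insert_disjoint[OF 2(1,2)] f_def [symmetric]
    by simp
qed

section \<open>Corners cut off from the hypersimplex\<close>

context sparse_paving
begin

definition excess :: "'n set \<Rightarrow> nat \<Rightarrow> ('n \<Rightarrow> nat) set" where
  "excess H t = {g. (\<forall>i. g i \<le> t) \<and> sum g UNIV = t * k \<and> t * (k - 1) < sum g H}"

text \<open>The sums over \<open>H\<close> and \<open>K\<close> would together exceed 2 t (k - 1),
  but the union contributes at most t k and the intersection at most t (k - 2).\<close>

lemma excess_disjoint:
  assumes "H \<in> \<H>" "K \<in> \<H>" "H \<noteq> K"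
  shows "excess H t \<inter> excess K t = {}"
proof (rule ccontr)
  assume "\<not> ?thesis"
  then obtain g where g: "\<And>i. g i \<le> t" "sum g UNIV = t * k" "t * (k - 1) < sum g H" "t * (k - 1) < sum g K"
    by (auto simp: excess_def)
  have "sum g (H \<inter> K) \<le> card (H \<inter> K) * t" using sum_bounded_above[of "H \<inter> K" g t] g by simp
  also have "\<dots> \<le> (k - 2) * t" using card_Int_hyperplanes[OF assms] by (intro mult_le_mono1) simp
  finally have "sum g (H \<inter> K) \<le> (k - 2) * t" .
  moreover have "sum g (H \<union> K) \<le> sum g UNIV" by (intro sum_mono2) auto
  moreover have "sum g (H \<union> K) + sum g (H \<inter> K) = sum g H + sum g K" by (simp add: sum.union_inter)
  ultimately have "t * (k - 1) + t * (k - 1) < t * k + t * (k - 2)" using g(2-4) by (simp add: mult.commute)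
  then have "t * ((k - 1) + (k - 1)) < t * (k + (k - 2))" by (simp only: distrib_left)
  moreover have "(k - 1) + (k - 1) = k + (k - 2)" using rank_ge_3 by linarith
  ultimately show False by simp
qed

text \<open>Reflecting the coordinates in \<open>H\<close> by g \<mapsto> t - g moves the corner to
  the origin: the sums over \<open>H\<close> and over its complement become equal to a common s < t.
  Each coordinate is then at most s, so the caps hold automatically and the count is a product of
  two stars and bars numbers.\<close>

lemma card_excess:
  assumes "H \<in> \<H>" and "CARD('n) = k + Suc b" and "k = Suc a"
  shows "card (excess H t) = (\<Sum>s<t. ((s + a) choose a) * ((s + b) choose b))" and "finite (excess H t)"
proof -
  have cards: "card H = Suc a" "card (- H) = Suc b"
    using card_hyperplane[OF assms(1)] assms by (auto simp: card_Compl)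
  let ?S = "\<lambda>s. {g :: 'n \<Rightarrow> nat. sum g H = s \<and> sum g (- H) = s}"
  let ?flip = "\<lambda>g i. if i \<in> H then t - g i else g i :: nat"
  have flip: "sum (?flip g) H = t * k - sum g H" "sum (?flip g) (- H) = sum g (- H)"
    if "\<And>i. g i \<le> t" for g
    using that by (auto simp: sum_subtractf_nat cards assms(3) mult.commute intro!: sum.cong)
  have "bij_betw ?flip (excess H t) (\<Union>s<t. ?S s)"
  proof (rule bij_betw_byWitness[where f' = ?flip])
    have small: "g i \<le> t" if g: "g \<in> ?S s" and "s < t" for g s i
    proof -
      have "g i \<le> sum g H \<or> g i \<le> sum g (- H)"
        using member_le_sum[of i H g] member_le_sum[of i "- H" g] by (cases "i \<in> H") auto
      then show ?thesis using that by auto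
    qed
    show "\<forall>g\<in>\<Union>s<t. ?S s. ?flip (?flip g) = g" using small by (fastforce simp: fun_eq_iff)
    show "\<forall>g\<in>excess H t. ?flip (?flip g) = g" by (auto simp: fun_eq_iff excess_def)
    show "?flip ` excess H t \<subseteq> (\<Union>s<t. ?S s)"
    proof (rule image_subsetI)
      fix g assume g: "g \<in> excess H t"
      then have le: "\<And>i. g i \<le> t" by (simp add: excess_def)
      have total: "sum g H + sum g (- H) = t * k" using g by (simp add: sum_add_sum_Compl excess_def)
      moreover have "t * k = t * (k - 1) + t" by (simp add: assms(3))
      ultimately have "sum g (- H) < t" using g unfolding excess_def by simp
      then show "?flip g \<in> (\<Union>s<t. ?S s)" using flip[OF le] total by (intro UN_I[of "sum g (- H)"]) auto
    qed
    show "?flip ` (\<Union>s<t. ?S s) \<subseteq> excess H t"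
    proof (rule image_subsetI)
      fix g assume "g \<in> (\<Union>s<t. ?S s)"
      then obtain s where s: "s < t" "sum g H = s" "sum g (- H) = s" by auto
      then have le: "\<And>i. g i \<le> t" using small[of g s] by auto
      have "sum g H \<le> card H * t" using sum_bounded_above[of H g t] le by simp
      then have "sum g H \<le> t * k" by (simp add: cards assms(3) mult.commute)
      moreover have "t * k = t * (k - 1) + t" by (simp add: assms(3))
      ultimately show "?flip g \<in> excess H t"
        using flip[OF le] s le sum_add_sum_Compl[of "?flip g" H] by (auto simp: excess_def)
    qed
  qed
  note bij = bij_betw_same_card[OF this] bij_betw_finite[OF this]
  have "card (\<Union>s<t. ?S s) = (\<Sum>s<t. card (?S s))"
    using card_split_compositions(2)[OF cards] by (intro card_UN_disjoint) auto
  also have "\<dots> = (\<Sum>s<t. ((s + a) choose a) * ((s + b) choose b))"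
    using card_split_compositions(1)[OF cards] by simp
  finally show "card (excess H t) = (\<Sum>s<t. ((s + a) choose a) * ((s + b) choose b))"
    using bij by simp
  show "finite (excess H t)" using bij card_split_compositions(2)[OF cards] by simp
qed

lemma card_lattice_points:
  assumes "CARD('n) = k + Suc b" and "k = Suc a"
  shows "int (card (lattice_points t)) =
    (\<Sum>j\<le>CARD('n). (-1) ^ j * int (CARD('n) choose j) * free_count (CARD('n) - 1) (int (t * k) - int j * int (t + 1)))
    - int (card \<H>) * int (\<Sum>s<t. ((s + a) choose a) * ((s + b) choose b))"
proof -
  let ?U = "\<Union>H\<in>\<H>. excess H t"
  have eq: "capped t (UNIV :: 'n set) (int (t * k)) = lattice_points t \<union> ?U"
    by (auto simp: capped_def lattice_points_def excess_def not_le simp del: of_nat_sum of_nat_mult)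
  have "lattice_points t \<inter> ?U = {}" by (auto simp: lattice_points_def excess_def)
  moreover have "finite (lattice_points t)"
    by (rule finite_subset[OF _ finite_bounded_functions[of t]]) (auto simp: lattice_points_def)
  moreover have "finite ?U" using card_excess(2)[OF _ assms] by simp
  ultimately have "card (capped t (UNIV :: 'n set) (int (t * k))) = card (lattice_points t) + card ?U"
    unfolding eq by (intro card_Un_disjoint)
  moreover have "card ?U = (\<Sum>H\<in>\<H>. card (excess H t))"
    using card_excess(2)[OF _ assms] excess_disjoint by (intro card_UN_disjoint) auto
  moreover have "\<dots> = card \<H> * (\<Sum>s<t. ((s + a) choose a) * ((s + b) choose b))"
    using card_excess(1)[OF _ assms] by simp
  ultimately have "int (card (lattice_points t)) = int (card (capped t (UNIV :: 'n set) (int (t * k)))) - int (card \<H> * (\<Sum>s<t. ((s + a) choose a) * ((s + b) choose b)))"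
    by simp
  moreover have "CARD('n) = Suc (CARD('n) - 1)" by simp
  note card_capped[OF this, of t UNIV "int (t * k)"]
  ultimately show ?thesis by (simp only: of_nat_mult)
qed

text \<open>This growth forces the degree of the counting polynomial up to the dimension. The points
  fill a box around the barycentre.\<close>

lemma card_lattice_points_ge:
  "(m + 1) ^ (CARD('n) - 1) \<le> card (lattice_points (CARD('n) * CARD('n) * m))"
proof -
  define n where "n = CARD('n)"
  fix i0 :: 'n
  let ?D = "(UNIV - {i0}) \<rightarrow>\<^sub>E {0..m}"
  \<comment> \<open>In the dilate by n * n * m the barycentre has all coordinates k * n * m. Every
    coordinate except \<open>i0\<close> rises by at most m, and \<open>i0\<close> compensates for
    the total.\<close>
  let ?f = "\<lambda>y i. if i = i0 then k * n * m - sum y (UNIV - {i0}) else k * n * m + y i"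
  \<comment> \<open>Up to the factor m these are the upper bound on a coordinate, nonnegativity at
    \<open>i0\<close>, and the inequality of a member of \<H>.\<close>
  have kn: "k * n + 1 \<le> n * n" "n - 1 \<le> k * n" "k * n * k + k \<le> n * n * (k - 1)"
  proof -
    have "n \<ge> 2 * k" "k \<ge> 3" using rank_le_half rank_ge_3 by (auto simp: n_def)
    then have "n \<le> k * n" "(k + 1) * n \<le> n * n" "1 \<le> n" by (simp, intro mult_le_mono1, simp_all)
    then show "n - 1 \<le> k * n" "k * n + 1 \<le> n * n"
      using diff_le_self[of n 1] by (auto simp only: distrib_right mult_1 intro: order_trans)
    have "k * k + 1 \<le> (k - 1) * n" using rank_sq_less by (simp add: n_def)
    then have "n * (k * k + 1) \<le> n * ((k - 1) * n)" by (rule mult_le_mono2)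
    then show "k * n * k + k \<le> n * n * (k - 1)" using \<open>n \<ge> 2 * k\<close> by (simp add: algebra_simps)
  qed
  have sum_le: "sum y (UNIV - {i0}) \<le> (n - 1) * m" if "y \<in> ?D" for y
    using sum_bounded_above[of "UNIV - {i0}" y m] that by (auto simp: n_def PiE_iff)
  have sub: "?f ` ?D \<subseteq> lattice_points (n * n * m)"
  proof clarify
    fix y assume y: "y \<in> ?D"
    have s: "sum y (UNIV - {i0}) \<le> k * n * m"
      using sum_le[OF y] mult_le_mono1[OF kn(2), of m] by linarith
    have bd: "?f y i \<le> k * n * m + m" for i using y by (auto simp: PiE_iff)
    show "?f y \<in> lattice_points (n * n * m)"
      unfolding lattice_points_def mem_Collect_eq
    proof (intro conjI allI ballI)
      fix i
      have "(k * n + 1) * m \<le> n * n * m" by (rule mult_le_mono1[OF kn(1)])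
      then show "?f y i \<le> n * n * m" using bd[of i] by (simp only: distrib_right)
    next
      have "sum (?f y) UNIV = ?f y i0 + sum (?f y) (UNIV - {i0})" by (rule sum.remove) auto
      also have "sum (?f y) (UNIV - {i0}) = sum (\<lambda>i. k * n * m + y i) (UNIV - {i0})" by (intro sum.cong) auto
      also have "\<dots> = (n - 1) * (k * n * m) + sum y (UNIV - {i0})" by (simp add: sum.distrib n_def)
      finally have "sum (?f y) UNIV = k * n * m + (n - 1) * (k * n * m)" using s by simp
      also have "\<dots> = Suc (n - 1) * (k * n * m)" by simp
      also have "Suc (n - 1) = n" by (simp add: n_def)
      finally show "sum (?f y) UNIV = n * n * m * k" by (simp add: mult_ac)
    next
      fix H assume "H \<in> \<H>"
      then have "sum (?f y) H \<le> k * (k * n * m + m)"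
        using sum_bounded_above[of H "?f y" "k * n * m + m"] bd card_hyperplane by simp
      also have "\<dots> = (k * n * k + k) * m" by (simp add: algebra_simps)
      also have "\<dots> \<le> n * n * (k - 1) * m" by (rule mult_le_mono1[OF kn(3)])
      finally show "sum (?f y) H \<le> n * n * m * (k - 1)" by (simp add: mult_ac)
    qed
  qed
  have inj: "inj_on ?f ?D"
  proof (rule inj_onI)
    fix y z assume yz: "y \<in> ?D" "z \<in> ?D" "?f y = ?f z"
    show "y = z"
    proof (rule PiE_ext[OF yz(1,2)])
      fix i assume "i \<in> UNIV - {i0}"
      then show "y i = z i" using fun_cong[OF yz(3), of i] by simp
    qed
  qed
  have fin: "finite (lattice_points (n * n * m))"
    by (rule finite_subset[OF _ finite_bounded_functions[of "n * n * m"]]) (auto simp: lattice_points_def)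
  have "card ?D \<le> card (lattice_points (n * n * m))" by (rule card_inj_on_le[OF inj sub fin])
  moreover have "card ?D = (m + 1) ^ (n - 1)" by (simp add: card_funcsetE n_def)
  ultimately show ?thesis by (simp add: n_def)
qed

end

section \<open>Quadratic coefficients\<close>

lemma of_nat_binomial_prod:
  "real ((m + N) choose N) = (\<Prod>i\<in>{1..N}. real m + real i) / fact N"
proof (induction N)
  case (Suc N)
  have "real (Suc N) * real ((m + Suc N) choose Suc N) = real (m + Suc N) * real ((m + N) choose N)"
    using Suc_times_binomial_eq[of "m + N" N] by (simp only: add_Suc_right flip: of_nat_mult) (simp add: mult.commute)
  then have step: "real ((m + Suc N) choose Suc N) = real (m + Suc N) * real ((m + N) choose N) / real (Suc N)"
    by (simp add: field_simps del: of_nat_Suc of_nat_add binomial_Suc_Suc add_Suc_right)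
  show ?case unfolding step Suc.IH by (simp add: ac_simps)
qed simp

text \<open>The second elementary symmetric polynomial of 1, 1/2, ..., 1/m.\<close>

fun harm_sq :: "nat \<Rightarrow> real" where
  "harm_sq 0 = 0"
| "harm_sq (Suc m) = harm_sq m + harm m / real (Suc m)"

lemma coeff_mult_linear:
  "coeff (p * [:a, b:]) 0 = a * coeff p 0"
  "coeff (p * [:a, b:]) (Suc i) = a * coeff p (Suc i) + b * coeff p i"
  for a b :: real
  by (simp_all add: mult.commute[of p])

text \<open>Taking i out of the i-th factor leaves m! times the product of the 1 + c x / i, whose
  coefficients are elementary symmetric in the numbers c / i.\<close>

lemma coeff_prod_linear:
  fixes c :: real
  defines "P \<equiv> \<lambda>m. \<Prod>i\<in>{1..m}. [:real i, c:]"
  shows "coeff (P m) 0 = fact m" and "coeff (P m) 1 = fact m * c * harm m"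
    and "coeff (P m) 2 = fact m * c\<^sup>2 * harm_sq m"
proof -
  have P: "P (Suc m) = P m * [:real (Suc m), c:]" for m
    by (simp add: P_def mult.commute)
  have 0: "coeff (P m) 0 = fact m" for m
    by (induction m) (simp_all add: P coeff_mult_linear del: of_nat_Suc, simp add: P_def)
  have 1: "coeff (P m) (Suc 0) = fact m * c * harm m" for m
  proof (induction m)
    case (Suc m)
    then show ?case unfolding P coeff_mult_linear 0 harm_Suc by (simp add: field_simps)
  qed (simp add: P_def harm_def)
  have "coeff (P m) (Suc (Suc 0)) = fact m * c\<^sup>2 * harm_sq m" for m
  proof (induction m)
    case (Suc m)
    then show ?case unfolding P coeff_mult_linear 1 harm_sq.simps by (simp add: field_simps power2_eq_square)
  qed (simp add: P_def)
  with 0 1 show "coeff (P m) 0 = fact m" "coeff (P m) 1 = fact m * c * harm m"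
    "coeff (P m) 2 = fact m * c\<^sup>2 * harm_sq m" by (simp_all add: numeral_2_eq_2)
qed

text \<open>With z = t k - j (t + 1) the factors are z + i, so this is N! times (z + N choose N) as
  a polynomial in t.\<close>

definition slice_factor :: "nat \<Rightarrow> nat \<Rightarrow> nat \<Rightarrow> real poly" where
  "slice_factor N k j = (\<Prod>i\<in>{1..N}. [:real i - real j, real k - real j:])"

text \<open>The polynomial also agrees with the truncated count where z is negative: then -z lies
  between 1 and j, because j < k, and the factor with i = -z vanishes.\<close>

lemma poly_slice_factor:
  assumes "j < k" "k \<le> N"
  shows "poly (slice_factor N k j) (real t) / fact N = of_int (free_count N (int (t * k) - int j * int (t + 1)))"
proof -
  define z where "z = int (t * k) - int j * int (t + 1)"
  have z: "of_int z + real i = real i - real j + real t * (real k - real j)" for i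
    by (simp add: z_def algebra_simps)
  have P: "poly (slice_factor N k j) (real t) = (\<Prod>i\<in>{1..N}. of_int z + real i)"
    by (simp add: slice_factor_def poly_prod z)
  show ?thesis
  proof (cases "z < 0")
    case True
    have "int t * int k \<ge> int t * int j" using assms by (intro mult_left_mono) auto
    then have "z \<ge> - int j" by (simp add: z_def algebra_simps)
    then have "nat (- z) \<in> {1..N}" "of_int z + real (nat (- z)) = 0" using True assms by auto
    then have "(\<Prod>i\<in>{1..N}. of_int z + real i) = 0" by (intro prod_zero) auto
    then show ?thesis using True unfolding P z_def [symmetric] by (simp add: free_count_def)
  next
    case False
    then have "of_int z = real (nat z)" by simp
    then show ?thesis using False of_nat_binomial_prod[of "nat z" N]
      unfolding P z_def [symmetric] by (simp add: free_count_def)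
  qed
qed

lemma coeff_2_slice_factor_0: "coeff (slice_factor N k 0) 2 = fact N * (real k)\<^sup>2 * harm_sq N"
  using coeff_prod_linear(3)[of "real k" N] by (simp add: slice_factor_def)

text \<open>The factor i = j has no constant term, so one linear coefficient of the remaining
  product is wanted. The factors with i < j have negative constant terms; reflecting i to j - i and
  extracting signs brings them into the form of \<open>coeff_prod_linear\<close>.\<close>

lemma coeff_2_slice_factor:
  assumes "1 \<le> j" "j \<le> N"
  shows "coeff (slice_factor N k j) 2 =
    (real k - real j)\<^sup>2 * (-1) ^ (j - 1) * fact (j - 1) * fact (N - j) * (harm (N - j) - harm (j - 1))"
proof -
  define c where "c = real k - real j"
  let ?f = "\<lambda>i. [:real i - real j, c:]"
  define P where "P = (\<Prod>i\<in>{1..j - 1}. [:real i, - c:])"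
  define Q where "Q = (\<Prod>i\<in>{1..N - j}. [:real i, c:])"
  have "{1..N} = insert j ({1..j - 1} \<union> {j + 1..N})" using assms by auto
  then have "prod f {1..N} = prod f {1..j - 1} * f j * prod f {j + 1..N}" for f :: "nat \<Rightarrow> real poly"
    using assms by (simp add: prod.union_disjoint mult_ac)
  then have "slice_factor N k j = (\<Prod>i\<in>{1..j - 1}. ?f i) * ?f j * (\<Prod>i\<in>{j + 1..N}. ?f i)"
    unfolding slice_factor_def c_def [symmetric] .
  moreover have "(\<Prod>i\<in>{j + 1..N}. ?f i) = Q"
    unfolding Q_def by (rule prod.reindex_bij_witness[of _ "\<lambda>i. i + j" "\<lambda>i. i - j"]) (auto simp: of_nat_diff)
  moreover have "(\<Prod>i\<in>{1..j - 1}. ?f i) = (\<Prod>i\<in>{1..j - 1}. - [:real i, - c:])"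
    by (rule prod.reindex_bij_witness[of _ "\<lambda>i. j - i" "\<lambda>i. j - i"]) (auto simp: of_nat_diff)
  moreover have "\<dots> = (-1) ^ (j - 1) * P"
    unfolding P_def prod_uminus by simp
  ultimately have "slice_factor N k j = [:0, c:] * ((-1) ^ (j - 1) * (P * Q))" by (simp add: mult_ac)
  also have "(-1) ^ (j - 1) * (P * Q) = smult ((-1) ^ (j - 1)) (P * Q)"
    by (cases "even (j - 1)") simp_all
  finally have "coeff (slice_factor N k j) (Suc (Suc 0)) = c * ((-1) ^ (j - 1) * coeff (P * Q) (Suc 0))" by simp
  also have "coeff (P * Q) (Suc 0) = coeff P 0 * coeff Q 1 + coeff P 1 * coeff Q 0"
    by (simp add: coeff_mult)
  also have "\<dots> = fact (j - 1) * fact (N - j) * c * (harm (N - j) - harm (j - 1))"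
    unfolding P_def Q_def coeff_prod_linear by (simp add: algebra_simps)
  finally show ?thesis by (simp add: c_def power2_eq_square numeral_2_eq_2)
qed

text \<open>The sum stops before k: for j \<ge> k the truncated count is 0 at every t, whereas the
  polynomial in general is not.\<close>

definition hypersimplex_poly :: "nat \<Rightarrow> nat \<Rightarrow> real poly" where
  "hypersimplex_poly n k = (\<Sum>j<k. smult ((-1) ^ j * real (n choose j) / fact (n - 1)) (slice_factor (n - 1) k j))"

lemma poly_hypersimplex:
  assumes "1 \<le> k" "k < n"
  shows "poly (hypersimplex_poly n k) (real t) =
    of_int (\<Sum>j\<le>n. (-1) ^ j * int (n choose j) * free_count (n - 1) (int (t * k) - int j * int (t + 1)))"
proof -
  have "free_count (n - 1) (int (t * k) - int j * int (t + 1)) = 0" if "k \<le> j" for j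
  proof -
    have "int t * int k \<le> int t * int j" using that by (intro mult_left_mono) auto
    then have "int (t * k) - int j * int (t + 1) < 0" using that assms by (simp add: algebra_simps)
    then show ?thesis by (simp add: free_count_def)
  qed
  then have "(\<Sum>j\<le>n. (-1) ^ j * int (n choose j) * free_count (n - 1) (int (t * k) - int j * int (t + 1)))
    = (\<Sum>j<k. (-1) ^ j * int (n choose j) * free_count (n - 1) (int (t * k) - int j * int (t + 1)))"
    using assms by (intro sum.mono_neutral_right) auto
  moreover have "poly (hypersimplex_poly n k) (real t) =
      (\<Sum>j<k. (-1) ^ j * real (n choose j) * (poly (slice_factor (n - 1) k j) (real t) / fact (n - 1)))"
    by (simp add: hypersimplex_poly_def poly_sum)
  moreover have "\<dots> = (\<Sum>j<k. (-1) ^ j * real (n choose j) * of_int (free_count (n - 1) (int (t * k) - int j * int (t + 1))))"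
    using assms by (intro sum.cong refl) (subst poly_slice_factor; simp)
  ultimately show ?thesis by simp
qed

lemma degree_hypersimplex_poly: "degree (hypersimplex_poly n k) \<le> n - 1"
  unfolding hypersimplex_poly_def
proof (intro degree_sum_le order_trans[OF degree_smult_le])
  fix j
  have "degree (slice_factor (n - 1) k j) \<le> sum (degree \<circ> (\<lambda>i. [:real i - real j, real k - real j:])) {1..n - 1}"
    unfolding slice_factor_def by (rule degree_prod_sum_le) simp
  also have "\<dots> \<le> (\<Sum>i\<in>{1..n - 1}. 1)" by (intro sum_mono) simp
  finally show "degree (slice_factor (n - 1) k j) \<le> n - 1" by simp
qed simp

text \<open>For j \<ge> 1 the sign (-1)^j of inclusion-exclusion meets the sign (-1)^(j-1) of
  \<open>coeff_2_slice_factor\<close>, so all these terms are subtracted. After cancelling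
  factorials, n / (j (n - j)) is left of the binomial coefficient.\<close>

definition hypersimplex_coeff :: "nat \<Rightarrow> nat \<Rightarrow> real" where
  "hypersimplex_coeff n k = (real k)\<^sup>2 * harm_sq (n - 1) -
    (\<Sum>j\<in>{1..<k}. (real k - real j)\<^sup>2 * real n / (real j * real (n - j)) * (harm (n - 1 - j) - harm (j - 1)))"

lemma coeff_2_hypersimplex_poly:
  assumes "1 \<le> k" "k < n"
  shows "coeff (hypersimplex_poly n k) 2 = hypersimplex_coeff n k"
proof -
  let ?c = "\<lambda>j. (-1) ^ j * real (n choose j) / fact (n - 1) * coeff (slice_factor (n - 1) k j) 2"
  have "?c j = - ((real k - real j)\<^sup>2 * real n / (real j * real (n - j)) * (harm (n - 1 - j) - harm (j - 1)))"
    if j: "j \<in> {1..<k}" for j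
  proof -
    obtain i where i: "j = Suc i" using j by (cases j) auto
    obtain m where m: "n = Suc i + Suc m" using j assms i by (metis add_Suc_right atLeastLessThan_iff less_natE order.strict_trans)
    have "real (n choose j) = fact n / (fact j * fact (n - j))"
      using m i by (intro binomial_fact) simp
    then have "real (n choose j) = fact (n - 1) * real n / (real j * real (n - j) * fact i * fact m)"
      using i m by (simp add: field_simps)
    moreover have "coeff (slice_factor (n - 1) k j) 2 =
      (real k - real j)\<^sup>2 * (-1) ^ i * fact i * fact m * (harm (n - 1 - j) - harm (j - 1))"
      using i m by (subst coeff_2_slice_factor) auto
    moreover have "(-1) ^ j * (-1) ^ i = (-1 :: real)" by (simp add: i flip: power_add)
    moreover have "real n > 0" "real j > 0" "real (n - j) > 0" using i m by auto
    ultimately show ?thesis by (simp add: i)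
  qed
  then have "(\<Sum>j\<in>{1..<k}. ?c j) = - (\<Sum>j\<in>{1..<k}. (real k - real j)\<^sup>2 * real n / (real j * real (n - j)) * (harm (n - 1 - j) - harm (j - 1)))"
    by (simp add: sum_negf)
  moreover have "?c 0 = (real k)\<^sup>2 * harm_sq (n - 1)" by (simp add: coeff_2_slice_factor_0)
  moreover have "{..<k} = insert 0 {1..<k}" using assms by auto
  ultimately show ?thesis
    by (simp add: hypersimplex_poly_def coeff_sum hypersimplex_coeff_def)
qed

text \<open>The binomial coefficient (t + m - 1 choose m) as a polynomial in t.\<close>

definition rising_poly :: "nat \<Rightarrow> real poly" where
  "rising_poly m = smult (1 / fact m) (\<Prod>i<m. [:real i, 1:])"

lemma rising_poly_0: "rising_poly 0 = 1"
  by (simp add: rising_poly_def)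

lemma rising_poly_Suc: "rising_poly (Suc m) = smult (1 / real (Suc m)) (rising_poly m * [:real m, 1:])"
  by (simp add: rising_poly_def mult.commute)

lemma coeff_rising_poly:
  "coeff (rising_poly (Suc m)) 0 = 0" "coeff (rising_poly (Suc m)) (Suc 0) = 1 / real (Suc m)"
  "coeff (rising_poly (Suc m)) (Suc (Suc 0)) = harm m / real (Suc m)"
proof -
  show 0: "coeff (rising_poly (Suc m)) 0 = 0" for m
    by (induction m) (simp_all add: rising_poly_Suc coeff_mult_linear)
  show 1: "coeff (rising_poly (Suc m)) (Suc 0) = 1 / real (Suc m)" for m
  proof (induction m)
    case 0
    then show ?case by (simp add: rising_poly_Suc rising_poly_0)
  next
    case (Suc m)
    then show ?case unfolding rising_poly_Suc[of "Suc m"] coeff_smult coeff_mult_linear 0 by (simp add: field_simps)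
  qed
  show "coeff (rising_poly (Suc m)) (Suc (Suc 0)) = harm m / real (Suc m)"
  proof (induction m)
    case 0
    then show ?case by (simp add: rising_poly_Suc rising_poly_0 harm_def)
  next
    case (Suc m)
    then show ?case unfolding rising_poly_Suc[of "Suc m"] coeff_smult coeff_mult_linear 1 harm_Suc
      by (simp add: field_simps)
  qed
qed

lemma degree_rising_poly: "degree (rising_poly m) \<le> m"
proof -
  have "degree (\<Prod>i<m. [:real i, 1:]) \<le> sum (degree \<circ> (\<lambda>i. [:real i, 1:])) {..<m}"
    by (rule degree_prod_sum_le) simp
  then show ?thesis unfolding rising_poly_def by (intro order_trans[OF degree_smult_le]) simp
qed

lemma poly_rising_poly: "poly (rising_poly (Suc b)) (real s) = real s / real (Suc b) * real ((s + b) choose b)"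
  and poly_rising_poly_Suc: "poly (rising_poly (Suc b)) (real (Suc s)) = (real s + real (Suc b)) / real (Suc b) * real ((s + b) choose b)"
proof -
  have *: "(\<Prod>i<Suc b. x + real i) = x * (\<Prod>i\<in>{1..b}. x + real i)" for x
    by (simp add: prod.lessThan_Suc_shift prod.atLeast1_atMost_eq del: prod.lessThan_Suc)
  have "poly (rising_poly (Suc b)) x = (\<Prod>i<Suc b. x + real i) / fact (Suc b)" for x
    by (simp add: rising_poly_def poly_prod add.commute del: prod.lessThan_Suc)
  note p = this
  show "poly (rising_poly (Suc b)) (real s) = real s / real (Suc b) * real ((s + b) choose b)"
    unfolding p * of_nat_binomial_prod by simp
  have "(\<Prod>i<Suc b. real (Suc s) + real i) = (\<Prod>i\<in>{1..Suc b}. real s + real i)"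
    by (rule prod.reindex_bij_witness[of _ "\<lambda>i. i - 1" Suc]) (auto simp: of_nat_diff)
  then show "poly (rising_poly (Suc b)) (real (Suc s)) = (real s + real (Suc b)) / real (Suc b) * real ((s + b) choose b)"
    unfolding p of_nat_binomial_prod by (simp add: add_ac)
qed

text \<open>Summation by parts in a yields this recursion for the sum in \<open>card_excess\<close>.
  It shows that the sum is polynomial in t and makes its coefficients accessible.\<close>

fun excess_poly :: "nat \<Rightarrow> nat \<Rightarrow> real poly" where
  "excess_poly b 0 = rising_poly (Suc b)"
| "excess_poly b (Suc a) = smult (1 / real (Suc b + Suc a))
     (smult (real (Suc a)) (excess_poly b a) + smult (real (Suc b)) (rising_poly (Suc b) * rising_poly (Suc a)))"

lemma poly_excess_poly:
  "poly (excess_poly b a) (real t) = real (\<Sum>s<t. ((s + a) choose a) * ((s + b) choose b))"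
proof (induction a)
  case 0
  show ?case
  proof (induction t)
    case 0
    show ?case by (simp add: poly_rising_poly[of b 0, simplified])
  next
    case (Suc t)
    have "poly (rising_poly (Suc b)) (real (Suc t)) = poly (rising_poly (Suc b)) (real t) + real ((t + b) choose b)"
      unfolding poly_rising_poly_Suc unfolding poly_rising_poly by (simp add: field_simps)
    then show ?case using Suc by simp
  qed
next
  case (Suc a)
  let ?D = "\<lambda>a t. real (\<Sum>s<t. ((s + a) choose a) * ((s + b) choose b))"
  have X: "real ((s + Suc a) choose Suc a) = (real s + real (Suc a)) / real (Suc a) * real ((s + a) choose a)" for s
    unfolding of_nat_binomial_prod by simp
  have "real (Suc b + Suc a) * ?D (Suc a) t = real (Suc a) * ?D a t +
      real (Suc b) * poly (rising_poly (Suc b)) (real t) * poly (rising_poly (Suc a)) (real t)" for t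
  proof (induction t)
    case 0
    show ?case by (simp add: poly_rising_poly[of b 0, simplified])
  next
    case (Suc t)
    define x y where "x = real ((t + a) choose a)" and "y = real ((t + b) choose b)"
    define A m where "A = real (Suc a)" and "m = real (Suc b)"
    have pos: "A > 0" "m > 0" by (simp_all add: A_def m_def)
    have D: "?D c (Suc t) = ?D c t + real ((t + c) choose c) * y" for c by (simp add: y_def)
    \<comment> \<open>The increments of both sides from t to t + 1, with the old product term moved
      to the left.\<close>
    have "(m + A) * ((real t + A) / A * x * y) + m * (real t / m * y) * (real t / A * x)
       = A * (x * y) + m * ((real t + m) / m * y) * ((real t + A) / A * x)"
      using pos by (simp add: field_simps)
    moreover have "real (Suc b + Suc a) = m + A" by (simp add: m_def A_def)
    ultimately show ?case
      using Suc.IH unfolding D X poly_rising_poly_Suc unfolding poly_rising_poly x_def[symmetric] y_def[symmetric]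
        A_def[symmetric] m_def[symmetric] by (simp only: distrib_left)
  qed
  then show ?case using Suc by (simp add: field_simps del: of_nat_Suc of_nat_sum of_nat_add)
qed

lemma degree_excess_poly: "degree (excess_poly b a) \<le> Suc b + a"
proof (induction a)
  case (Suc a)
  have "degree (rising_poly (Suc b) * rising_poly (Suc a)) \<le> Suc b + Suc a"
    by (rule order_trans[OF degree_mult_le add_mono[OF degree_rising_poly degree_rising_poly]])
  then show ?case using Suc unfolding excess_poly.simps
    by (intro order_trans[OF degree_smult_le] degree_add_le) auto
qed (simp add: degree_rising_poly)

text \<open>The summand \<open>1 / real (Suc a)\<close> comes from the product of the linear terms
  of the two rising polynomials; their factor 1 / (b + 1) cancels against the weight b + 1.\<close>

fun excess_coeff :: "nat \<Rightarrow> nat \<Rightarrow> real" where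
  "excess_coeff b 0 = harm b / real (Suc b)"
| "excess_coeff b (Suc a) = (real (Suc a) * excess_coeff b a + 1 / real (Suc a)) / real (Suc b + Suc a)"

lemma coeff_2_excess_poly: "coeff (excess_poly b a) 2 = excess_coeff b a"
proof (induction a)
  case 0
  show ?case by (simp add: numeral_2_eq_2 coeff_rising_poly)
next
  case (Suc a)
  have "coeff (rising_poly (Suc b) * rising_poly (Suc a)) 2 = 1 / real (Suc b) * (1 / real (Suc a))"
    by (simp add: coeff_mult numeral_2_eq_2 coeff_rising_poly)
  then show ?case
    unfolding excess_poly.simps excess_coeff.simps coeff_smult coeff_add Suc.IH
    by (simp del: of_nat_Suc of_nat_add)
qed

section \<open>The Ehrhart polynomial\<close>

text \<open>If p had smaller degree, (1 + x)^d - p(c x) would have leading coefficient 1 and be at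
  least 1 eventually, but it is at most 0 at every natural number.\<close>

lemma degree_ge_of_growth:
  fixes p :: "real poly"
  assumes "\<And>m :: nat. real ((m + 1) ^ d) \<le> poly p (c * real m)"
  shows "d \<le> degree p"
proof (rule ccontr)
  assume "\<not> d \<le> degree p"
  define q where "q = - pcompose p [:0, c:] + [:1, 1:] ^ d"
  have deg: "degree ([:1, 1 :: real:] ^ d) = d" by (simp add: degree_power_eq)
  moreover have "degree (- pcompose p [:0, c:]) \<le> degree p"
    by (simp add: order_trans[OF degree_pcompose_le])
  ultimately have "lead_coeff q = lead_coeff ([:1, 1 :: real:] ^ d)"
    unfolding q_def using \<open>\<not> d \<le> degree p\<close> by (intro lead_coeff_add_le) linarith
  then have "lead_coeff q = 1" by (simp add: lead_coeff_power)
  then obtain x where x: "\<And>y. y \<ge> x \<Longrightarrow> poly q y \<ge> 1"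
    using poly_pinfty_gt_lc[of q] by auto
  obtain m where m: "real m \<ge> x" using real_arch_simple by blast
  have "poly q (real m) = (1 + real m) ^ d - poly p (c * real m)"
    by (simp add: q_def poly_pcompose mult.commute)
  also have "\<dots> \<le> 0" using assms[of m] by (simp add: add.commute)
  finally show False using x[OF m] by simp
qed

context sparse_paving
begin

definition ehrhart :: "real poly" where
  "ehrhart = hypersimplex_poly CARD('n) k - smult (real (card \<H>)) (excess_poly (CARD('n) - k - 1) (k - 1))"

lemma poly_ehrhart: "poly ehrhart (real t) = real (card (lattice_points t))"
proof -
  have eqs: "CARD('n) = k + Suc (CARD('n) - k - 1)" "k = Suc (k - 1)"
    using rank_ge_3 rank_le_half by auto
  have "real (card (lattice_points t)) = of_int (int (card (lattice_points t)))" by simp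
  then show ?thesis
    unfolding card_lattice_points[OF eqs]
    using poly_hypersimplex[of k "CARD('n)" t] rank_ge_3 rank_le_half
    by (simp add: ehrhart_def poly_excess_poly del: of_nat_sum)
qed

lemma degree_ehrhart: "degree ehrhart = CARD('n) - 1"
proof (rule antisym)
  have "degree (excess_poly (CARD('n) - k - 1) (k - 1)) \<le> CARD('n) - 1"
    using degree_excess_poly[of "CARD('n) - k - 1" "k - 1"] rank_ge_3 rank_le_half by simp
  then show "degree ehrhart \<le> CARD('n) - 1"
    unfolding ehrhart_def by (intro degree_diff_le degree_hypersimplex_poly order_trans[OF degree_smult_le])
  show "CARD('n) - 1 \<le> degree ehrhart"
  proof (rule degree_ge_of_growth)
    fix m :: nat
    have "real ((m + 1) ^ (CARD('n) - 1)) \<le> real (card (lattice_points (CARD('n) * CARD('n) * m)))"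
      using card_lattice_points_ge by (simp only: of_nat_le_iff)
    then show "real ((m + 1) ^ (CARD('n) - 1)) \<le> poly ehrhart (real (CARD('n) * CARD('n)) * real m)"
      by (simp only: poly_ehrhart flip: of_nat_mult)
  qed
qed

lemma ehrhart_poly_bases: "ehrhart_poly (base_polytope bases) = ehrhart"
  unfolding ehrhart_poly_def
proof (rule the_equality)
  show *: "is_ehrhart_poly (base_polytope bases) ehrhart"
    using rank_ge_3 rank_le_half
    by (simp add: is_ehrhart_poly_def degree_ehrhart aff_dim_base_polytope poly_ehrhart card_integer_points of_nat_diff)
  show "p = ehrhart" if "is_ehrhart_poly (base_polytope bases) p" for p
    using is_ehrhart_poly_unique[OF that *] .
qed

lemma not_ehrhart_positive:
  assumes "hypersimplex_coeff CARD('n) k \<le> real (card \<H>) * excess_coeff (CARD('n) - k - 1) (k - 1)"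
  shows "\<not> ehrhart_positive (base_polytope bases)"
proof
  assume "ehrhart_positive (base_polytope bases)"
  moreover have "int 2 \<le> aff_dim (base_polytope bases)"
    using rank_ge_3 rank_le_half by (simp add: aff_dim_base_polytope)
  ultimately have "coeff ehrhart 2 > 0" by (simp add: ehrhart_positive_def ehrhart_poly_bases)
  moreover have "coeff ehrhart 2 \<le> 0"
    using assms coeff_2_hypersimplex_poly[of k "CARD('n)"] rank_ge_3 rank_le_half
    by (simp add: ehrhart_def coeff_2_excess_poly)
  ultimately show False by simp
qed

end

section \<open>Comparison of the quadratic coefficients\<close>

lemma harm_sq_numeral:
  "harm_sq (numeral m) = harm_sq (pred_numeral m) + harm (pred_numeral m) / numeral m"
  using harm_sq.simps(2)[of "pred_numeral m"] by (simp only: numeral_eq_Suc [symmetric] of_nat_numeral)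

lemma excess_coeff_numeral:
  "excess_coeff b (numeral a) = (numeral a * excess_coeff b (pred_numeral a) + 1 / numeral a) / (real (Suc b) + numeral a)"
  using excess_coeff.simps(2)[of b "pred_numeral a"]
  by (simp only: numeral_eq_Suc [symmetric] of_nat_numeral of_nat_add)

text \<open>For j < k \<le> n / 2 the differences of harmonic numbers in the subtracted sum are
  nonnegative.\<close>

lemma hypersimplex_coeff_le:
  assumes "2 * k \<le> n"
  shows "hypersimplex_coeff n k \<le> (real k)\<^sup>2 * harm_sq (n - 1)"
proof -
  have "harm (j - 1) \<le> (harm (n - 1 - j) :: real)" if "j \<in> {1..<k}" for j
    using that assms by (intro harm_mono) auto
  then have "0 \<le> (\<Sum>j\<in>{1..<k}. (real k - real j)\<^sup>2 * real n / (real j * real (n - j)) *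
      (harm (n - 1 - j) - harm (j - 1)))"
    by (intro sum_nonneg mult_nonneg_nonneg divide_nonneg_nonneg) auto
  then show ?thesis by (simp add: hypersimplex_coeff_def)
qed

lemma excess_coeff_nonneg: "excess_coeff b a \<ge> 0"
  by (induction a) (auto simp: harm_nonneg)

text \<open>Only the newest summand of the recursion is kept.\<close>

lemma excess_coeff_ge: "1 / (real (Suc a) * real (Suc b + Suc a)) \<le> excess_coeff b (Suc a)"
proof -
  have "1 / real (Suc a) \<le> real (Suc a) * excess_coeff b a + 1 / real (Suc a)"
    using excess_coeff_nonneg by simp
  from divide_right_mono[OF this, of "real (Suc b + Suc a)"] show ?thesis
    by (simp only: excess_coeff.simps divide_divide_eq_left of_nat_0_le_iff)
qed

lemma harm_le: "harm m \<le> real m"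
proof (induction m)
  case (Suc m)
  have "inverse (real (Suc m)) \<le> 1" by (simp add: inverse_le_1_iff)
  then show ?case using Suc unfolding harm_Suc by simp
qed (simp add: harm_def)

lemma harm_sq_mono: "m \<le> m' \<Longrightarrow> harm_sq m \<le> harm_sq m'"
  by (rule lift_Suc_mono_le[of harm_sq]) (auto simp: harm_nonneg)

text \<open>The two increments add at most 2, and \<open>harm_sq\<close> has passed 2 by then. The
  bound 25 is n - 1 for the smallest n treated by induction.\<close>

lemma harm_sq_add_2:
  assumes "m \<ge> 25"
  shows "harm_sq (m + 2) \<le> 2 * harm_sq m"
proof -
  have "harm_sq 25 \<ge> 2" by (simp add: harm_sq_numeral harm_expand)
  then have "harm_sq m \<ge> 2" using harm_sq_mono[OF assms] by simp
  moreover have "harm m / real (Suc m) \<le> 1" for m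
    using harm_le[of m] by (simp add: field_simps)
  from this[of m] this[of "Suc m"]
  have "harm m / real (Suc m) + harm (Suc m) / real (Suc (Suc m)) \<le> 2" by linarith
  moreover have "harm_sq (m + 2) = harm_sq m + (harm m / real (Suc m) + harm (Suc m) / real (Suc (Suc m)))"
    by (simp add: numeral_2_eq_2)
  ultimately show ?thesis by linarith
qed

text \<open>Here n = 2 k + e, with e the parity of n. From n to n + 2 the binomial coefficient grows
  by a factor near 4, while \<open>harm_sq\<close> at most doubles; \<open>key\<close> says that the
  polynomial factors stay within the rest. At k = 12 the inequality fails for both parities.\<close>

lemma central_binomial_ge:
  assumes "k \<ge> 13" "e \<le> 1"
  shows "real (2 * k + e) * real (2 * k + e - 1) * real (k - 1) * (real k)\<^sup>2 * harm_sq (2 * k + e - 1)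
    \<le> real ((2 * k + e) choose k)"
  using assms(1)
proof (induction k rule: dec_induct)
  case base
  have "e = 0 \<or> e = 1" using assms(2) by auto
  then show ?case
    by (elim disjE; simp only:)
      (simp_all add: harm_sq_numeral harm_expand binomial_fact fact_numeral)
next
  case (step k)
  define n where "n = 2 * k + e"
  have e: "real n = 2 * real k + real e" "real e \<ge> 0" "real e \<le> 1" "real k \<ge> 13" "n \<ge> 26" "k < n"
    using step assms by (auto simp: n_def)
  \<comment> \<open>After this shift, right side minus left side of the quartic inequality has only
    nonnegative coefficients.\<close>
  define x where "x = real k - 13"
  have x: "real k = x + 13" "x \<ge> 0" using e by (auto simp: x_def)
  have "2 * (real k + 1) ^ 3 * (real k + real e + 1) \<le> 2 * (real k + 1) ^ 3 * (real k + 2)"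
    using e by (intro mult_left_mono) auto
  also have "\<dots> \<le> (2 * real k) * (2 * real k - 1) * (real k - 1) * real k"
    using x(2) unfolding x(1) by (simp add: algebra_simps power3_eq_cube)
  also have "\<dots> \<le> real n * (real n - 1) * (real k - 1) * real k"
    using e by (intro mult_right_mono mult_mono) auto
  finally have key: "2 * (real k + 1) ^ 3 * (real k + real e + 1) \<le> real n * (real n - 1) * (real k - 1) * real k" .
  have bin: "real ((n + 2) choose (k + 1)) * ((real k + 1) * (real k + real e + 1)) = real (n choose k) * ((real n + 2) * (real n + 1))"
  proof -
    have "real ((n + 2) choose (k + 1)) = fact (n + 2) / (fact (k + 1) * fact (k + e + 1))"
      using binomial_fact[of "k + 1" "n + 2", where 'a = real] by (simp add: n_def)
    moreover have "real (n choose k) = fact n / (fact k * fact (k + e))"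
      using binomial_fact[of k n, where 'a = real] by (simp add: n_def)
    moreover have "fact (n + 2) = (real n + 2) * (real n + 1) * fact n"
      by (simp add: numeral_2_eq_2 add.commute)
    moreover have "fact (k + 1) = (real k + 1) * fact k" "fact (k + e + 1) = (real k + real e + 1) * fact (k + e)"
      by simp_all
    moreover have "real k + 1 \<noteq> 0" "real k + real e + 1 \<noteq> 0" by linarith+
    ultimately show ?thesis by (simp only:) (simp add: divide_simps)
  qed
  have IH: "real n * (real n - 1) * (real k - 1) * (real k)\<^sup>2 * harm_sq (n - 1) \<le> real (n choose k)"
    using step.IH e by (simp add: n_def of_nat_diff)
  let ?A = "(real n + 2) * (real n + 1) * real k * (real k + 1)\<^sup>2"
  have H: "harm_sq (n + 1) \<le> 2 * harm_sq (n - 1)" "harm_sq (n - 1) \<ge> 0"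
    using harm_sq_add_2[of "n - 1"] harm_sq_mono[of 0 "n - 1"] e by (simp_all add: numeral_2_eq_2)
  have "?A * harm_sq (n + 1) * ((real k + 1) * (real k + real e + 1)) \<le>
      ?A * (2 * harm_sq (n - 1)) * ((real k + 1) * (real k + real e + 1))"
    using H e by (intro mult_right_mono mult_left_mono) auto
  also have "\<dots> = (real n + 2) * (real n + 1) * real k * harm_sq (n - 1) * (2 * (real k + 1) ^ 3 * (real k + real e + 1))"
    by (simp add: power3_eq_cube power2_eq_square)
  also have "\<dots> \<le> (real n + 2) * (real n + 1) * real k * harm_sq (n - 1) * (real n * (real n - 1) * (real k - 1) * real k)"
    using key H by (intro mult_left_mono) auto
  also have "\<dots> = (real n + 2) * (real n + 1) * (real n * (real n - 1) * (real k - 1) * (real k)\<^sup>2 * harm_sq (n - 1))"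
    by (simp add: power2_eq_square)
  also have "\<dots> \<le> (real n + 2) * (real n + 1) * real (n choose k)"
    using IH by (intro mult_left_mono) auto
  also have "\<dots> = real ((n + 2) choose (k + 1)) * ((real k + 1) * (real k + real e + 1))"
    by (simp only: bin mult.commute)
  finally have "?A * harm_sq (n + 1) \<le> real ((n + 2) choose (k + 1))"
    using e by (subst (asm) mult_le_cancel_right_pos) auto
  moreover have "2 * Suc k + e = n + 2" by (simp add: n_def)
  ultimately show ?case by (simp add: add.commute)
qed

text \<open>From n = 26 on, one-term bounds for both coefficients suffice, and
  \<open>central_binomial_ge\<close> is the inequality between them. These bounds are too weak at n
  = 25, so the cases 20 to 25 are evaluated exactly.\<close>

lemma hypersimplex_coeff_le_excess_coeff:
  assumes "n \<ge> 20"
  defines "k \<equiv> n div 2"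
  shows "real n * hypersimplex_coeff n k \<le> real (n choose k) * excess_coeff (n - k - 1) (k - 1)"
proof (cases "n \<ge> 26")
  case True
  define e where "e = n mod 2"
  have n: "n = 2 * k + e" "e \<le> 1" by (auto simp: k_def e_def)
  have k: "k \<ge> 13" using True by (simp add: k_def)
  have "hypersimplex_coeff n k \<le> (real k)\<^sup>2 * harm_sq (n - 1)"
    using n by (intro hypersimplex_coeff_le) simp
  then have "real n * hypersimplex_coeff n k \<le> real n * ((real k)\<^sup>2 * harm_sq (n - 1))"
    by (intro mult_left_mono) auto
  also have "\<dots> \<le> real (n choose k) * (1 / (real (k - 1) * real (n - 1)))"
  proof -
    have "real n * ((real k)\<^sup>2 * harm_sq (n - 1)) * (real (k - 1) * real (n - 1)) \<le> real (n choose k)"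
      using central_binomial_ge[OF k n(2)] unfolding n(1) [symmetric] by (simp only: mult_ac)
    moreover have "real (k - 1) * real (n - 1) > 0" using k n by simp
    ultimately show ?thesis by (simp only: pos_le_divide_eq mult_1_right times_divide_eq_right)
  qed
  also have "\<dots> \<le> real (n choose k) * excess_coeff (n - k - 1) (k - 1)"
  proof -
    have "Suc (k - 2) = k - 1" "Suc (n - k - 1) + (k - 1) = n - 1" using k n by linarith+
    then have "1 / (real (k - 1) * real (n - 1)) \<le> excess_coeff (n - k - 1) (k - 1)"
      using excess_coeff_ge[of "k - 2" "n - k - 1"] by simp
    then show ?thesis by (intro mult_left_mono) auto
  qed
  finally show ?thesis .
next
  case False
  then have "n \<in> {20, 21, 22, 23, 24, 25}" using assms(1) by auto
  then show ?thesis unfolding k_def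
    by (elim insertE emptyE)
      (simp_all add: hypersimplex_coeff_def harm_sq_numeral harm_expand excess_coeff_numeral
        atLeastLessThan_nat_numeral binomial_fact fact_numeral)
qed

text \<open>6327 = 37 * 9 * 19: 37 orbits under nine multipliers and 19 translations.\<close>

lemma hypersimplex_coeff_19: "hypersimplex_coeff 19 9 \<le> 6327 * excess_coeff 9 8"
  by (simp add: hypersimplex_coeff_def harm_sq_numeral harm_expand excess_coeff_numeral
        atLeastLessThan_nat_numeral)

section \<open>A constant weight code of length 19\<close>

definition affine19 :: "int \<Rightarrow> int \<Rightarrow> int set \<Rightarrow> int set" where
  "affine19 a c V = (\<lambda>y. (a * y + c) mod 19) ` V"

text \<open>Orbit representatives under the maps \<open>y \<mapsto> a y + c\<close> with \<open>a\<close> a nonzero square modulo 19,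
  found by computer search. Each orbit has 171 elements. The argument needs at least 6245 words, whereas
  the pigeonhole bound gives only 4862.\<close>

definition reps19 :: "int list list" where
  "reps19 =
    [[0,1,2,3,4,5,13,14,15], [0,1,2,3,4,8,11,13,15], [0,1,2,3,5,6,10,13,17],
     [0,1,2,3,5,8,11,13,14], [0,1,2,3,6,13,16,17,18], [0,1,2,3,7,12,16,17,18],
     [0,1,2,3,8,11,16,17,18], [0,1,2,3,10,13,14,15,18], [0,1,2,4,6,7,9,11,17],
     [0,1,2,4,6,7,10,12,15], [0,1,2,4,9,11,14,17,18], [0,1,2,5,8,13,14,15,18],
     [0,1,3,4,5,6,7,15,16], [0,1,3,4,5,6,9,14,15], [0,1,3,4,5,14,15,16,18],
     [1,2,3,4,5,7,10,12,13], [1,2,3,4,5,9,10,11,12], [1,2,3,4,6,7,9,12,13],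
     [1,2,3,4,6,11,15,16,18], [1,2,3,4,7,13,14,15,17], [1,2,3,4,8,12,14,15,17],
     [1,2,3,5,6,11,13,17,18], [1,2,3,5,6,12,14,16,17], [1,2,3,5,7,12,13,16,17],
     [1,2,3,5,8,9,14,16,18], [1,2,3,5,8,10,14,16,17], [1,2,3,5,9,11,13,14,18],
     [1,2,3,6,7,11,13,16,17], [1,2,3,6,9,10,13,14,18], [1,2,3,6,9,11,12,15,17],
     [1,2,3,8,9,10,11,15,17], [1,2,3,8,9,10,12,14,17], [1,2,3,8,9,10,12,15,16],
     [1,2,4,5,6,9,15,16,18], [1,2,4,5,6,11,13,16,18], [1,2,4,5,7,11,13,15,18],
     [1,2,4,6,7,10,11,17,18]]"

definition squares19 :: "int list" where
  "squares19 = [1, 4, 5, 6, 7, 9, 11, 16, 17]"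

text \<open>On 8-element sets the fingerprint is invariant under translation modulo 19, because
  \<open>1 + 7 * 8 = 3 * 19\<close>.\<close>

definition fingerprint :: "int set \<Rightarrow> int" where
  "fingerprint U = (\<Sum>e\<in>U. 2 ^ nat ((e + 7 * \<Sum>U) mod 19))"

text \<open>The simplifier rewrites below abstractions, so functions meant for \<open>code_simp\<close> recurse
  explicitly instead of mapping an abstraction over a list.\<close>

definition power_mod19 :: "int \<Rightarrow> int" where
  "power_mod19 z = (if z < 19 then 2 ^ nat z else 2 ^ nat (z - 19))"

primrec powers_sum :: "int \<Rightarrow> int list \<Rightarrow> int" where
  "powers_sum r [] = 0"
| "powers_sum r (e # es) = power_mod19 (e + r) + powers_sum r es"

definition fingerprint_list :: "int list \<Rightarrow> int" where
  "fingerprint_list es = powers_sum (7 * sum_list es mod 19) es"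

primrec scale19 :: "int \<Rightarrow> int list \<Rightarrow> int list" where
  "scale19 a [] = []"
| "scale19 a (y # ys) = (a * y mod 19) # scale19 a ys"

primrec fingerprints :: "int list \<Rightarrow> int list \<Rightarrow> int list" where
  "fingerprints us [] = []"
| "fingerprints us (a # as) = fingerprint_list (scale19 a us) # fingerprints us as"

text \<open>The value 0 flags a repetition. It is never a minimum of fingerprints, which are positive.\<close>

definition summary :: "int list \<Rightarrow> int" where
  "summary ks = (if distinct ks then foldr min ks (2 ^ 19) else 0)"

text \<open>One entry for each deleted point. Minimising the fingerprints over the nine multipliers
  gives an invariant of the orbit of the remaining 8-set, so two orbits whose words share an 8-set
  would show a common entry.\<close>

primrec signatures :: "int list \<Rightarrow> int list \<Rightarrow> int list" where
  "signatures R [] = []"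
| "signatures R (x # xs) = summary (fingerprints (remove1 x R) squares19) # signatures R xs"

primrec all_signatures :: "int list list \<Rightarrow> int list" where
  "all_signatures [] = []"
| "all_signatures (R # Rs) = signatures R R @ all_signatures Rs"

text \<open>Distinctness by quicksort-style pivoting, which takes fewer comparisons than testing all
  pairs.\<close>

fun separated :: "'a::linorder list \<Rightarrow> bool" where
  "separated [] = True"
| "separated (x # xs) = (x \<notin> set xs \<and>
     separated (filter (\<lambda>y. y < x) xs) \<and> separated (filter (\<lambda>y. x < y) xs))"

lemma reps19_wf:
  "list_all (\<lambda>R. length R = 9 \<and> distinct R \<and> list_all (\<lambda>y. 0 \<le> y \<and> y < 19) R) reps19"
  by code_simp

lemma card_reps19: "card (set reps19) = 37"
proof -
  have "length (remdups reps19) = 37" by code_simp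
  then show ?thesis by (simp add: length_remdups_card_conv)
qed

text \<open>The leading 0 lets one evaluation establish two facts: the 333 signatures are distinct,
  and none of them is the repetition flag. Hence the nine fingerprints of each punctured
  representative differ.\<close>

lemma separated_signatures19: "separated (0 # all_signatures reps19)"
  by code_simp

lemma distinct_filterI: "distinct (filter P xs) \<Longrightarrow> distinct (filter (\<lambda>y. \<not> P y) xs) \<Longrightarrow> distinct xs"
  by (induction xs) (auto split: if_splits)

lemma separated_imp_distinct: "separated xs \<Longrightarrow> distinct xs"
proof (induction xs rule: separated.induct)
  case (2 x xs)
  have x: "x \<notin> set xs" and IH: "distinct (filter (\<lambda>y. y < x) xs)" "distinct (filter (\<lambda>y. x < y) xs)"
    using 2 by auto
  have "filter (\<lambda>y. \<not> y < x) xs = filter (\<lambda>y. x < y) xs"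
    by (rule filter_cong) (use x in \<open>auto simp: not_less order_le_less\<close>)
  then have "distinct (filter (\<lambda>y. \<not> y < x) xs)" using IH(2) by (simp only:)
  with IH(1) have "distinct xs" by (rule distinct_filterI)
  then show ?case using x by simp
qed simp

section \<open>Correctness of the evaluated functions\<close>

lemma all_signatures_eq:
  "all_signatures Rs = map (\<lambda>(R, x). summary (fingerprints (remove1 x R) squares19))
    (concat (map (\<lambda>R. map (Pair R) R) Rs))"
proof -
  have "signatures R xs = map (\<lambda>x. summary (fingerprints (remove1 x R) squares19)) xs" for R xs
    by (induction xs) auto
  then show ?thesis by (induction Rs) (auto simp: case_prod_beta comp_def)
qed

lemma fingerprints_eq: "fingerprints us as = map (\<lambda>a. fingerprint_list (scale19 a us)) as"
  by (induction as) auto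

lemma scale19_eq: "scale19 a us = map (\<lambda>y. a * y mod 19) us"
  by (induction us) auto

text \<open>Entry and shift are both below 19, so a single subtraction in \<open>power_mod19\<close>
  reduces their sum.\<close>

lemma powers_sum_eq:
  assumes "0 \<le> r" "r < 19" "\<forall>e\<in>set es. 0 \<le> e \<and> e < 19"
  shows "powers_sum r es = (\<Sum>e\<leftarrow>es. 2 ^ nat ((e + r) mod 19))"
  using assms(3)
proof (induction es)
  case (Cons e es)
  have "power_mod19 (e + r) = 2 ^ nat ((e + r) mod 19)"
  proof (cases "e + r < 19")
    case False
    then have "(e + r) mod 19 = e + r - 19" using Cons.prems assms
      by (subst mod_pos_pos_trivial [symmetric, of "e + r - 19" 19]) auto
    then show ?thesis using False by (simp add: power_mod19_def)
  qed (use Cons.prems assms in \<open>simp add: power_mod19_def\<close>)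
  then show ?case using Cons by simp
qed simp

lemma fingerprint_list_eq:
  assumes "distinct es" "set es \<subseteq> {0..<19}"
  shows "fingerprint_list es = fingerprint (set es)"
proof -
  have "fingerprint_list es = (\<Sum>e\<leftarrow>es. 2 ^ nat ((e + 7 * sum_list es mod 19) mod 19))"
    unfolding fingerprint_list_def using assms(2) by (intro powers_sum_eq) auto
  then show ?thesis using assms(1)
    by (simp add: fingerprint_def sum_list_distinct_conv_sum_set distinct_sum_list_conv_Sum mod_add_right_eq)
qed

section \<open>Affine maps modulo 19 and their invariants\<close>

lemma affine19_subset: "affine19 a c V \<subseteq> {0..<19}"
  by (auto simp: affine19_def)

lemma affine19_affine19: "affine19 b d (affine19 a c V) = affine19 (b * a) (b * c + d) V"
proof -
  have "(b * ((a * y + c) mod 19) + d) mod 19 = (b * (a * y + c) + d) mod 19" for y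
    by (metis mod_add_left_eq mod_mult_right_eq)
  then show ?thesis by (simp add: affine19_def image_image algebra_simps)
qed

lemma affine19_mod: "affine19 (a mod 19) c V = affine19 a c V"
proof -
  have "(a mod 19 * y + c) mod 19 = (a * y + c) mod 19" for y
    by (metis mod_add_left_eq mod_mult_left_eq)
  then show ?thesis by (simp add: affine19_def)
qed

lemma inj_on_affine19:
  fixes a c :: int
  assumes "coprime a 19"
  shows "inj_on (\<lambda>y. (a * y + c) mod 19) {0..<19}"
proof (rule inj_onI)
  fix y z assume yz: "y \<in> {0..<19 :: int}" "z \<in> {0..<19}" "(a * y + c) mod 19 = (a * z + c) mod 19"
  then have "19 dvd (a * y + c) - (a * z + c)" by (simp only: mod_eq_dvd_iff)
  then have "19 dvd a * (y - z)" by (simp add: algebra_simps)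
  then have "19 dvd y - z" using assms by (simp add: coprime_dvd_mult_right_iff coprime_commute)
  then have "y mod 19 = z mod 19" by (simp only: mod_eq_dvd_iff)
  then show "y = z" using yz by simp
qed

lemma card_affine19:
  assumes "coprime a 19" "V \<subseteq> {0..<19}"
  shows "card (affine19 a c V) = card V"
  unfolding affine19_def using inj_on_affine19[OF assms(1)] assms(2)
  by (intro card_image) (rule inj_on_subset)

lemma sum_affine19:
  assumes "coprime a 19" "V \<subseteq> {0..<19}"
  shows "\<Sum>(affine19 a c V) mod 19 = (a * \<Sum>V + int (card V) * c) mod 19"
proof -
  have "\<Sum>(affine19 a c V) = (\<Sum>y\<in>V. (a * y + c) mod 19)"
    unfolding affine19_def using inj_on_subset[OF inj_on_affine19[OF assms(1)] assms(2)]
    by (simp add: sum.reindex)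
  then show ?thesis by (simp add: mod_sum_eq sum.distrib sum_distrib_left)
qed

text \<open>Shifting an 8-set U by \<open>7 * \<Sum>U\<close> moves it to its translate with sum 0
  modulo 19, and the powers of two record this canonical translate as a bit mask.\<close>

lemma fingerprint_translate:
  assumes "card V = 8" "V \<subseteq> {0..<19}"
  shows "fingerprint (affine19 1 c V) = fingerprint V"
proof -
  let ?s = "\<Sum>(affine19 1 c V)"
  have "((y + c) mod 19 + 7 * ?s) mod 19 = (y + 7 * \<Sum>V) mod 19" for y
  proof -
    have "((y + c) mod 19 + 7 * ?s) mod 19 = (y + c + 7 * (?s mod 19)) mod 19"
      by (metis mod_add_left_eq mod_add_right_eq mod_mult_right_eq)
    also have "?s mod 19 = (\<Sum>V + 8 * c) mod 19" using sum_affine19[of 1 V c] assms by simp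
    also have "(y + c + 7 * ((\<Sum>V + 8 * c) mod 19)) mod 19 = (y + c + 7 * (\<Sum>V + 8 * c)) mod 19"
      by (metis mod_add_right_eq mod_mult_right_eq)
    also have "y + c + 7 * (\<Sum>V + 8 * c) = (y + 7 * \<Sum>V) + 19 * (3 * c)" by simp
    finally show ?thesis by (simp only: mod_mult_self2)
  qed
  moreover have "inj_on (\<lambda>y. (1 * y + c) mod 19) V"
    by (rule inj_on_subset[OF inj_on_affine19 assms(2)]) simp
  ultimately show ?thesis
    unfolding fingerprint_def by (simp add: affine19_def sum.reindex)
qed

lemma coprime_squares19: "a \<in> set squares19 \<Longrightarrow> coprime a 19"
proof -
  have "list_all (\<lambda>a. gcd a 19 = 1) squares19" by code_simp
  then show "a \<in> set squares19 \<Longrightarrow> coprime a 19" by (simp add: list_all_iff coprime_iff_gcd_eq_1)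
qed

lemma squares19_mult: "a \<in> set squares19 \<Longrightarrow> (\<lambda>b. b * a mod 19) ` set squares19 = set squares19"
proof -
  assume "a \<in> set squares19"
  then have "a = 1 \<or> a = 4 \<or> a = 5 \<or> a = 6 \<or> a = 7 \<or> a = 9 \<or> a = 11 \<or> a = 16 \<or> a = 17"
    by (simp add: squares19_def)
  then show ?thesis by (elim disjE) (simp_all add: squares19_def set_eq_subset)
qed

lemma fingerprint_affine19:
  assumes "a \<in> set squares19" "distinct us" "length us = 8" "set us \<subseteq> {0..<19}"
  shows "fingerprint (affine19 a c (set us)) = fingerprint_list (scale19 a us)"
proof -
  note co = coprime_squares19[OF assms(1)]
  have card: "card (set us) = 8" using assms(2,3) by (simp add: distinct_card)
  have "fingerprint (affine19 a c (set us)) = fingerprint (affine19 1 c (affine19 a 0 (set us)))"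
    by (simp add: affine19_affine19)
  also have "\<dots> = fingerprint (affine19 a 0 (set us))"
    using card by (intro fingerprint_translate affine19_subset) (simp add: card_affine19[OF co assms(4)])
  also have "affine19 a 0 (set us) = set (scale19 a us)" by (simp add: affine19_def scale19_eq)
  also have "fingerprint (set (scale19 a us)) = fingerprint_list (scale19 a us)"
  proof (rule fingerprint_list_eq [symmetric])
    have "inj_on (\<lambda>y. a * y mod 19) (set us)"
      using inj_on_subset[OF inj_on_affine19[OF co, of 0] assms(4)] by simp
    then show "distinct (scale19 a us)" using assms(2) by (simp add: scale19_eq distinct_map)
  qed (auto simp: scale19_eq)
  finally show ?thesis .
qed

text \<open>Multiplication by a permutes the squares and translations do not affect fingerprints, so
  an affine map merely permutes the nine fingerprints of a set.\<close>

lemma fingerprints_affine19: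
  assumes "a \<in> set squares19" "distinct us" "length us = 8" "set us \<subseteq> {0..<19}"
  shows "(\<lambda>b. fingerprint (affine19 b 0 (affine19 a c (set us)))) ` set squares19 = set (fingerprints us squares19)"
proof -
  have "fingerprint (affine19 b 0 (affine19 a c (set us))) = fingerprint_list (scale19 (b * a mod 19) us)"
    if "b \<in> set squares19" for b
  proof -
    have "b * a mod 19 \<in> set squares19" using squares19_mult[OF assms(1)] that by blast
    from fingerprint_affine19[OF this assms(2-4), of "b * c"] show ?thesis
      by (simp add: affine19_affine19 affine19_mod)
  qed
  then have "(\<lambda>b. fingerprint (affine19 b 0 (affine19 a c (set us)))) ` set squares19
      = (\<lambda>a. fingerprint_list (scale19 a us)) ` (\<lambda>b. b * a mod 19) ` set squares19"
    by (simp add: image_image)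
  then show ?thesis by (simp add: squares19_mult[OF assms(1)] fingerprints_eq)
qed

lemma foldr_min_eq: "foldr min ks m = Min (insert m (set ks))" for m :: "'a::linorder"
proof (induction ks)
  case (Cons k ks)
  have "Min (insert m (insert k (set ks))) = min k (Min (insert m (set ks)))"
    by (subst insert_commute, subst Min_insert) auto
  then show ?case using Cons by simp
qed simp

text \<open>The orbit and the position of the deleted point are read off the signature, the multiplier off
  the fingerprint, and the translation off the sum of the elements.\<close>

lemma punctured_word_unique:
  assumes R: "R \<in> set reps19" "a \<in> set squares19" "c \<in> {0..<19}"
    and R': "R' \<in> set reps19" "a' \<in> set squares19" "c' \<in> {0..<19}"
    and U: "U \<subseteq> affine19 a c (set R)" "U \<subseteq> affine19 a' c' (set R')" "card U = 8"
  shows "R = R' \<and> a = a' \<and> c = c'"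
proof -
  have wf: "length R = 9" "distinct R" "set R \<subseteq> {0..<19}" if "R \<in> set reps19" for R
    using reps19_wf that by (auto simp: list_all_iff)
  have puncture: "\<exists>x\<in>set R. U = affine19 a c (set (remove1 x R)) \<and> distinct (remove1 x R) \<and>
      length (remove1 x R) = 8 \<and> set (remove1 x R) \<subseteq> {0..<19}"
    if word: "R \<in> set reps19" "a \<in> set squares19" "U \<subseteq> affine19 a c (set R)" for R a c
  proof -
    let ?f = "\<lambda>y. (a * y + c) mod 19"
    note w = wf[OF word(1)]
    have inj: "inj_on ?f (set R)"
      using inj_on_subset[OF inj_on_affine19[OF coprime_squares19[OF word(2)]] w(3)] .
    obtain V where V: "V \<subseteq> set R" "U = ?f ` V"
      using word(3) by (auto simp: affine19_def subset_image_iff)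
    have "card V = 8" using U(3) V inj by (metis card_image inj_on_subset)
    then have "card (set R - V) = 1"
      using w V by (simp add: card_Diff_subset finite_subset distinct_card)
    then obtain x where "set R - V = {x}" by (rule card_1_singletonE)
    then have "x \<in> set R" "V = set R - {x}" using V by auto
    then show ?thesis using w V by (intro bexI[of _ x]) (auto simp: affine19_def length_remove1)
  qed
  obtain x where x: "x \<in> set R" "U = affine19 a c (set (remove1 x R))"
    and us: "distinct (remove1 x R)" "length (remove1 x R) = 8" "set (remove1 x R) \<subseteq> {0..<19}"
    using puncture[OF R(1,2) U(1)] by blast
  obtain x' where x': "x' \<in> set R'" "U = affine19 a' c' (set (remove1 x' R'))"
    and us': "distinct (remove1 x' R')" "length (remove1 x' R') = 8" "set (remove1 x' R') \<subseteq> {0..<19}"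
    using puncture[OF R'(1,2) U(2)] by blast
  define P where "P = concat (map (\<lambda>R. map (Pair R) R) reps19)"
  define f where "f = (\<lambda>(R, x). summary (fingerprints (remove1 x R) squares19))"
  have "distinct (0 # map f P)"
    using separated_imp_distinct[OF separated_signatures19] by (simp add: all_signatures_eq P_def f_def)
  then have inj: "inj_on f (set P)" and "0 \<notin> f ` set P" by (auto simp: distinct_map)
  have mem: "(R, x) \<in> set P" "(R', x') \<in> set P"
    using R(1) R'(1) x(1) x'(1) by (auto simp: P_def)
  then have dist: "distinct (fingerprints (remove1 x R) squares19)" "distinct (fingerprints (remove1 x' R') squares19)"
    using \<open>0 \<notin> f ` set P\<close> by (force simp: f_def summary_def split: if_splits)+
  have "set (fingerprints (remove1 x R) squares19) = set (fingerprints (remove1 x' R') squares19)"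
    using fingerprints_affine19[OF R(2) us, of c] fingerprints_affine19[OF R'(2) us', of c'] x(2) x'(2) by simp
  then have "f (R, x) = f (R', x')" using dist by (simp add: f_def summary_def foldr_min_eq)
  then have same: "R = R'" "x = x'" using inj mem by (auto simp: inj_on_def)
  have "fingerprint_list (scale19 a (remove1 x R)) = fingerprint_list (scale19 a' (remove1 x R))"
    using fingerprint_affine19[OF R(2) us, of c] fingerprint_affine19[OF R'(2) us', of c'] x(2) x'(2) same by simp
  then have a: "a = a'"
    using dist(1) R(2) R'(2) by (auto simp: fingerprints_eq distinct_map inj_on_def)
  define V where "V = set (remove1 x R)"
  have V: "card V = 8" "V \<subseteq> {0..<19}" using us by (simp_all only: V_def distinct_card)
  have Uc: "U = affine19 a c V" "U = affine19 a c' V" using x(2) x'(2) same a by (simp_all only: V_def)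
  have sums: "\<Sum>U mod 19 = (a * \<Sum>V + int (card V) * c) mod 19"
      "\<Sum>U mod 19 = (a * \<Sum>V + int (card V) * c') mod 19"
    using sum_affine19[OF coprime_squares19[OF R(2)] V(2)] Uc by metis+
  \<comment> \<open>Translating eight elements by c adds 8 c to their sum. Since 8 is invertible
    modulo 19, the sum determines c.\<close>
  have "(8 * c + a * \<Sum>V) mod 19 = (8 * c' + a * \<Sum>V) mod 19"
    using sums unfolding V(1) by (simp only: of_nat_numeral add.commute)
  moreover have "gcd 8 (19 :: int) = 1" by code_simp
  then have "coprime 8 (19 :: int)" by (simp only: coprime_iff_gcd_eq_1)
  ultimately have "c = c'" using inj_onD[OF inj_on_affine19] R(3) R'(3) by blast
  with same a show ?thesis by simp
qed

lemma code19:
  assumes "CARD('n::finite) = 19"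
  shows "\<exists>\<H> :: 'n set set. distance_four 9 \<H> \<and> card \<H> = 6327"
proof -
  have "card {0..<19 :: int} = CARD('n)" using assms by simp
  then obtain h :: "int \<Rightarrow> 'n" where h: "bij_betw h {0..<19} UNIV"
    by (meson finite_same_card_bij finite finite_atLeastLessThan_int)
  define I where "I = set reps19 \<times> set squares19 \<times> {0..<19 :: int}"
  define w where "w = (\<lambda>(R, a, c). h ` affine19 a c (set R))"
  have inj_h: "inj_on h {0..<19}" using h by (simp add: bij_betw_def)
  have card_w: "card (w i) = 9" if iI: "i \<in> I" for i
  proof -
    obtain R a c where i: "i = (R, a, c)" "R \<in> set reps19" "a \<in> set squares19" using iI by (auto simp: I_def)
    have "length R = 9" "distinct R" "set R \<subseteq> {0..<19}" using reps19_wf i(2) by (auto simp: list_all_iff)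
    then have "card (affine19 a c (set R)) = 9"
      using card_affine19[OF coprime_squares19[OF i(3)]] by (simp add: distinct_card)
    then show ?thesis
      using card_image[OF inj_on_subset[OF inj_h affine19_subset]] by (simp add: w_def i(1))
  qed
  have unique: "i = j" if ij: "i \<in> I" "j \<in> I" and big: "8 \<le> card (w i \<inter> w j)" for i j
  proof -
    obtain R a c R' a' c' where i: "i = (R, a, c)" "j = (R', a', c')" by (metis prod_cases3)
    let ?A = "affine19 a c (set R)" and ?B = "affine19 a' c' (set R')"
    have "w i \<inter> w j = h ` (?A \<inter> ?B)"
      unfolding w_def i using inj_on_image_Int[OF inj_h affine19_subset affine19_subset] by simp
    moreover have "inj_on h (?A \<inter> ?B)" using affine19_subset by (blast intro: inj_on_subset[OF inj_h])
    ultimately have "8 \<le> card (?A \<inter> ?B)" using big by (simp add: card_image)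
    then obtain U where "U \<subseteq> ?A \<inter> ?B" "card U = 8" by (meson obtain_subset_with_card_n)
    then show ?thesis using punctured_word_unique[of R a c R' a' c' U] ij by (simp add: I_def i)
  qed
  \<comment> \<open>Equal words share nine points, so \<open>unique\<close> also gives
    injectivity.\<close>
  have "inj_on w I" using unique card_w by (intro inj_onI) simp
  then have "card (w ` I) = card I" by (rule card_image)
  also have "card (set squares19) = 9" by (simp add: squares19_def)
  then have "card I = 6327" by (simp add: I_def card_cartesian_product card_reps19)
  finally have "card (w ` I) = 6327" .
  moreover have "distance_four 9 (w ` I)"
    unfolding distance_four_def
  proof (intro conjI ballI impI)
    fix H K assume HK: "H \<in> w ` I" "K \<in> w ` I" "H \<noteq> K"
    then obtain i j where ij: "i \<in> I" "j \<in> I" "H = w i" "K = w j" by blast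
    then have "\<not> 8 \<le> card (H \<inter> K)" using unique[of i j] HK(3) by blast
    then show "card (H \<inter> K) + 2 \<le> 9" by simp
  qed (use card_w in auto)
  ultimately show ?thesis by blast
qed

section \<open>Connected matroids that are not Ehrhart positive\<close>

theorem theorem1p6:
  assumes "CARD('n::finite) \<ge> 19"
  shows "\<exists>\<B> :: 'n set set. matroid UNIV \<B> \<and> matroid_connected UNIV \<B> \<and>
           \<not> ehrhart_positive (base_polytope \<B>)"
proof -
  \<comment> \<open>The middle rank maximises the binomial coefficient and with it the guaranteed
    number of corners.\<close>
  define k where "k = CARD('n) div 2"
  have "\<exists>\<H> :: 'n set set. distance_four k \<H> \<and>
      hypersimplex_coeff CARD('n) k \<le> real (card \<H>) * excess_coeff (CARD('n) - k - 1) (k - 1)"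
  proof (cases "CARD('n) = 19")
    case True
    then have "k = 9" by (simp add: k_def)
    moreover obtain \<H> :: "'n set set" where "distance_four 9 \<H>" "card \<H> = 6327"
      using code19[OF True] by blast
    ultimately show ?thesis using hypersimplex_coeff_19 True by (intro exI[of _ \<H>]) simp
  next
    case False
    then have n: "CARD('n) \<ge> 20" using assms by simp
    obtain \<H> :: "'n set set" where \<H>: "distance_four k \<H>" "CARD('n) choose k \<le> CARD('n) * card \<H>"
      using graham_sloane[of k, where 'n = 'n] by blast
    let ?d = "excess_coeff (CARD('n) - k - 1) (k - 1)"
    have "real CARD('n) * hypersimplex_coeff CARD('n) k \<le> real (CARD('n) choose k) * ?d"
      unfolding k_def by (rule hypersimplex_coeff_le_excess_coeff[OF n])
    also have "\<dots> \<le> real (CARD('n) * card \<H>) * ?d"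
      using \<H>(2) excess_coeff_nonneg by (intro mult_right_mono) (simp_all only: of_nat_le_iff)
    also have "\<dots> = real CARD('n) * (real (card \<H>) * ?d)" by simp
    finally show ?thesis using \<H>(1) by (intro exI[of _ \<H>] conjI) simp_all
  qed
  then obtain \<H> :: "'n set set" where "distance_four k \<H>"
    and le: "hypersimplex_coeff CARD('n) k \<le> real (card \<H>) * excess_coeff (CARD('n) - k - 1) (k - 1)"
    by blast
  moreover have "3 \<le> k" "2 * k \<le> CARD('n)" using assms by (auto simp: k_def)
  ultimately interpret sparse_paving \<H> k by unfold_locales
  show ?thesis
    using matroid_bases matroid_connected_bases not_ehrhart_positive[OF le] by blast
qed

end
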